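(* For $k\ge i\ge1$, \[ \sum_{N_1\ge\cdots\ge N_{k-1}\ge0}\frac{(-q^{2-2N_1};q^2)_{N_1-1}(-q^{1-2N_1};q^2)_{N_1}\,q^{2(N_1^2+\cdots+N_{k-1}^2+N_{i+1}+\cdots+N_{k-1})}(1+q^{2N_i})}{(q^2;q^2)_{N_1-N_2}\cdots(q^2;q^2)_{N_{k-2}-N_{k-1}}(q^2;q^2)_{N_{k-1}}} =\frac{(-q;q)_\infty\,(q^{2i-1},q^{4k-1-2i},q^{4k-2};q^{4k-2})_\infty}{(q;q)_\infty}. \]
   Context: $(a;q)_\infty=\prod_{j\ge0}(1-aq^j)$, $(a;q)_n=(a;q)_\infty/(aq^n;q)_\infty$ for every integer $n$, and $(a_1,\dots,a_m;q)_\infty=(a_1;q)_\infty\cdots(a_m;q)_\infty$. The sum runs over integer tuples $(N_1,\dots,N_{k-1})$ with $N_1\ge\cdots\ge N_{k-1}\ge0$; empty sums are $0$, and in the case $i=k$ one sets $N_k=0$. *)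

theory Defs
  imports "HOL-Analysis.Analysis"
begin

definition qpoch_inf :: "complex \<Rightarrow> complex \<Rightarrow> complex" where
  "qpoch_inf a q = (\<Prod>j. 1 - a * q ^ j)"

definition qpoch :: "complex \<Rightarrow> complex \<Rightarrow> int \<Rightarrow> complex" where
  "qpoch a q n = qpoch_inf a q / qpoch_inf (a * q powi n) q"

definition qpochs_inf :: "complex list \<Rightarrow> complex \<Rightarrow> complex" where
  "qpochs_inf as q = (\<Prod>a\<leftarrow>as. qpoch_inf a q)"

text \<open>
  A tuple \<open>(N\<^sub>1, \<dots>, N\<^sub>k\<^sub>-\<^sub>1)\<close> is a function on the indices \<open>1, \<dots>, k - 1\<close>, extended by \<open>0\<close> to all
  other indices. Each tuple thus has exactly one representative, and the convention \<open>N\<^sub>k = 0\<close>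
  is built in.
\<close>

definition tuples :: "nat \<Rightarrow> (nat \<Rightarrow> int) set" where
  "tuples k = {N. (\<forall>j\<in>{1..<k}. 0 \<le> N j) \<and>
                  (\<forall>j. 1 \<le> j \<and> j + 1 < k \<longrightarrow> N (j + 1) \<le> N j) \<and>
                  (\<forall>j. j \<notin> {1..<k} \<longrightarrow> N j = 0)}"

text \<open>
  For \<open>k = 1\<close> the denominator is an empty product; below, its last factor is then
  \<open>qpoch (q\<^sup>2) (q\<^sup>2) (N 0) = 1\<close>, because \<open>N 0 = 0\<close>.
\<close>

definition summand :: "nat \<Rightarrow> nat \<Rightarrow> complex \<Rightarrow> (nat \<Rightarrow> int) \<Rightarrow> complex" where
  "summand k i q N =
     qpoch (- (q powi (2 - 2 * N 1))) (q\<^sup>2) (N 1 - 1) *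
     qpoch (- (q powi (1 - 2 * N 1))) (q\<^sup>2) (N 1) *
     q powi (2 * ((\<Sum>j\<in>{1..<k}. (N j)\<^sup>2) + (\<Sum>j\<in>{i+1..<k}. N j))) *
     (1 + q powi (2 * N i)) /
     ((\<Prod>j\<in>{1..<k-1}. qpoch (q\<^sup>2) (q\<^sup>2) (N j - N (j + 1))) * qpoch (q\<^sup>2) (q\<^sup>2) (N (k - 1)))"

end

theory Submission
  imports Defs
begin

text \<open>
  Iterate Bailey's lemma in base \<open>p = q\<^sup>2\<close>, starting from the innermost index. From the unit Bailey pair
  relative to \<open>a = p\<close>, the indices \<open>N\<^sub>k = 0, N\<^sub>k\<^sub>-\<^sub>1, \<dots>, N\<^sub>i\<^sub>+\<^sub>1\<close> multiply the coefficient
  \<open>c\<^sub>s = (-1)\<^sup>s p\<^bsup>s(s-1)/2\<^esup>\<close>, \<open>s \<in> \<int>\<close>, by a factor \<open>p\<^bsup>s(s+1)\<^esup>\<close> each. The reflection \<open>s \<mapsto> -s-1\<close>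
  shows that the factor \<open>1 + p\<^bsup>N i\<^esup>\<close> turns this into a pair relative to \<open>a = 1\<close> with coefficients
  \<open>(1 + p\<^sup>s) c\<^sub>s\<close>; the indices \<open>N\<^sub>i, \<dots>, N\<^sub>2\<close> then contribute a factor \<open>p\<^bsup>s*s\<^esup>\<close> each. The sum over \<open>N\<^sub>1\<close> is an
  instance of the \<open>q\<close>-Gauss sum and equals \<open>(-q;q)\<^sub>\<infinity> / (q;q)\<^sub>\<infinity> * q\<^sup>s / (1 + p\<^sup>s)\<close>, which cancels \<open>1 + p\<^sup>s\<close>.
  What remains is a theta series, evaluated by Jacobi's triple product.
\<close>

section \<open>Infinite sums and products\<close>

text \<open>Classical Bailey pairs have coefficients indexed by s >= 0, which for a = 1 makes s = 0
  exceptional. Letting s run over all integers folds s with -s-1 for a = p and s with -s for a = 1;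
  the coefficients become uniform, and passing from a = p to a = 1 is a regrouping inside one sum.
  The level at which this happens decides how many steps contribute s^2 + s instead of s^2, hence
  the linear term of the theta exponent (2k-1) s^2 + 2 (k-i) s.

  The outermost index is of another kind. Once N_1 is fixed all inner sums are finite, but the
  factor q^(2 N_1^2) is used up by the negative powers in the two shifted factorials, and only
  q^(N_1) is left. Convergence is therefore merely geometric, and exchanging the sums over N_1 and s
  relies on the kernel vanishing for |s| > N_1. The q-Gauss evaluation is not taken from a general
  formula: a recurrence in s reduces it to the limit s -> infinity, where Euler's sum remains. The
  kernel for a = 1 also supplies the coefficients of a finite triple product, whose limit is
  Jacobi's.\<close>

lemma summable_on_dominated:
  fixes f :: "'a \<Rightarrow> 'c :: banach" and h :: "'a \<Rightarrow> real"
  assumes "h summable_on A" and "\<And>x. x \<in> A \<Longrightarrow> norm (f x) \<le> h x"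
  shows "f summable_on A"
  by (rule abs_summable_summable[OF Infinite_Sum.abs_summable_on_comparison_test'[OF assms]])

text \<open>Dominated convergence for unordered sums: the majorant makes the finite partial sums
  converge uniformly in \<open>n\<close>, so the two limits commute. Since \<open>T\<close> enters
  as the limit of known sums, the lemma also evaluates the limiting series.\<close>

lemma has_sum_tannery:
  fixes f :: "'b \<Rightarrow> 'a \<Rightarrow> 'c :: banach" and h :: "'a \<Rightarrow> real"
  assumes bound: "\<And>n x. x \<in> A \<Longrightarrow> norm (f n x) \<le> h x"
    and h: "h summable_on A"
    and lim: "\<And>x. x \<in> A \<Longrightarrow> ((\<lambda>n. f n x) \<longlongrightarrow> g x) G"
    and sums: "\<And>n. (f n has_sum S n) A"
    and "G \<noteq> bot" and S: "(S \<longlongrightarrow> T) G"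
  shows "(g has_sum T) A"
proof -
  have "norm (g x) \<le> h x" if "x \<in> A" for x
    by (rule tendsto_upperbound[OF tendsto_norm[OF lim[OF that]]])
       (use bound[OF that] \<open>G \<noteq> bot\<close> in auto)
  hence g: "g summable_on A" by (rule summable_on_dominated[OF h])
  have "(S \<longlongrightarrow> infsum g A) G"
  proof (rule swap_uniform_limit')
    show "(sum g \<longlongrightarrow> infsum g A) (finite_subsets_at_top A)"
      using g by (rule infsum_tendsto)
    show "\<forall>\<^sub>F X in finite_subsets_at_top A. ((\<lambda>n. \<Sum>x\<in>X. f n x) \<longlongrightarrow> sum g X) G"
      using lim by (intro eventually_finite_subsets_at_top_weakI tendsto_sum) auto
    show "uniform_limit UNIV (\<lambda>X n. \<Sum>x\<in>X. f n x) S (finite_subsets_at_top A)"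
      by (rule Weierstrass_m_test_general'[OF _ sums h]) (use bound in auto)
  qed auto
  hence "T = infsum g A"
    using S \<open>G \<noteq> bot\<close> tendsto_unique by blast
  thus ?thesis using g by simp
qed

lemma has_sum_cmult_right_cancel:
  fixes c :: "'b :: real_normed_field"
  assumes "c \<noteq> 0" and "((\<lambda>x. c * f x) has_sum c * b) A"
  shows "(f has_sum b) A"
  using has_sum_cmult_right[OF assms(2), of "inverse c"] assms(1)
  by (simp add: mult.assoc[symmetric])

lemma has_sum_sum:
  fixes f :: "'b \<Rightarrow> 'a \<Rightarrow> 'c :: topological_comm_monoid_add"
  assumes "finite I" and "\<And>r. r \<in> I \<Longrightarrow> (f r has_sum b r) A"
  shows "((\<lambda>x. \<Sum>r\<in>I. f r x) has_sum (\<Sum>r\<in>I. b r)) A"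
  using assms by (induction I rule: finite_induct) (auto intro!: has_sum_add)

section \<open>Infinite q-shifted factorials\<close>

lemma convergent_prod_qpoch_inf:
  fixes a q :: complex
  assumes "norm q < 1"
  shows "convergent_prod (\<lambda>j. 1 - a * q ^ j)"
proof -
  have "summable (\<lambda>j. norm a * norm q ^ j)"
    using assms by (intro summable_mult summable_geometric) auto
  hence "abs_convergent_prod (\<lambda>j. 1 - a * q ^ j)"
    by (simp add: abs_convergent_prod_conv_summable norm_mult norm_power)
  thus ?thesis by (rule abs_convergent_prod_imp_convergent_prod)
qed

lemma qpoch_inf_LIMSEQ:
  assumes "norm q < 1"
  shows "(\<lambda>n. \<Prod>j<n. 1 - a * q ^ j) \<longlonglongrightarrow> qpoch_inf a q"
proof -
  have "(\<lambda>n. \<Prod>j\<le>n. 1 - a * q ^ j) \<longlonglongrightarrow> qpoch_inf a q"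
    unfolding qpoch_inf_def by (rule convergent_prod_LIMSEQ[OF convergent_prod_qpoch_inf[OF assms]])
  hence "(\<lambda>n. \<Prod>j<Suc n. 1 - a * q ^ j) \<longlonglongrightarrow> qpoch_inf a q"
    by (simp add: lessThan_Suc_atMost)
  thus ?thesis by (rule LIMSEQ_imp_Suc)
qed

lemma qpoch_inf_split:
  assumes "norm q < 1"
  shows "qpoch_inf a q = (\<Prod>j<n. 1 - a * q ^ j) * qpoch_inf (a * q ^ n) q"
proof -
  have "(\<lambda>m. \<Prod>j<m + n. 1 - a * q ^ j) \<longlonglongrightarrow> qpoch_inf a q"
    by (rule LIMSEQ_ignore_initial_segment[OF qpoch_inf_LIMSEQ[OF assms]])
  moreover have "(\<Prod>j<m + n. 1 - a * q ^ j) = (\<Prod>j<n. 1 - a * q ^ j) * (\<Prod>j<m. 1 - a * q ^ n * q ^ j)" for m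
    by (induction m) (auto simp: power_add mult_ac)
  moreover have "(\<lambda>m. (\<Prod>j<n. 1 - a * q ^ j) * (\<Prod>j<m. 1 - a * q ^ n * q ^ j))
      \<longlonglongrightarrow> (\<Prod>j<n. 1 - a * q ^ j) * qpoch_inf (a * q ^ n) q"
    by (intro tendsto_mult tendsto_const qpoch_inf_LIMSEQ assms)
  ultimately show ?thesis
    using LIMSEQ_unique by simp
qed

lemma qpoch_inf_nonzero:
  assumes "norm q < 1" and "\<And>j. a * q ^ j \<noteq> 1"
  shows "qpoch_inf a q \<noteq> 0"
  unfolding qpoch_inf_def
  by (rule prodinf_nonzero) (use assms in \<open>auto simp: convergent_prod_qpoch_inf\<close>)

lemma qpoch_inf_nonzero_of_norm_less:
  assumes "norm q < 1" and "norm a < 1"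
  shows "qpoch_inf a q \<noteq> 0"
proof (rule qpoch_inf_nonzero)
  fix j
  have "norm (a * q ^ j) < 1"
    using assms by (simp add: norm_mult norm_power)
       (metis norm_ge_zero power_le_one less_eq_real_def mult_left_le order_le_less_trans)
  thus "a * q ^ j \<noteq> 1" by auto
qed (use assms in auto)

lemma qpoch_inf_even_odd:
  assumes "norm q < 1"
  shows "qpoch_inf a (q\<^sup>2) * qpoch_inf (a * q) (q\<^sup>2) = qpoch_inf a q"
proof -
  have q2: "norm (q\<^sup>2) < 1"
    using assms by (simp add: norm_power power_less_one_iff)
  have "(\<lambda>n. \<Prod>j<2 * n. 1 - a * q ^ j) \<longlonglongrightarrow> qpoch_inf a q"
    using LIMSEQ_subseq_LIMSEQ[OF qpoch_inf_LIMSEQ[OF assms, of a], of "\<lambda>n. 2 * n"]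
    by (auto simp: strict_mono_def o_def)
  moreover have "(\<Prod>j<2 * n. 1 - a * q ^ j)
      = (\<Prod>j<n. 1 - a * (q\<^sup>2) ^ j) * (\<Prod>j<n. 1 - a * q * (q\<^sup>2) ^ j)" for n
    by (induction n) (auto simp: power_mult[symmetric] mult_ac)
  moreover have "(\<lambda>n. (\<Prod>j<n. 1 - a * (q\<^sup>2) ^ j) * (\<Prod>j<n. 1 - a * q * (q\<^sup>2) ^ j))
      \<longlonglongrightarrow> qpoch_inf a (q\<^sup>2) * qpoch_inf (a * q) (q\<^sup>2)"
    by (intro tendsto_mult qpoch_inf_LIMSEQ q2)
  ultimately show ?thesis
    using LIMSEQ_unique by simp
qed

section \<open>Convergent majorants\<close>

lemma summable_theta_nat:
  fixes r x :: real
  assumes "0 < r" "r < 1" "x > 0"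
  shows "summable (\<lambda>n. x ^ n * r ^ (n * (n - 1)))"
proof -
  have Suc: "x ^ Suc n * r ^ (Suc n * (Suc n - 1)) = x * (r\<^sup>2) ^ n * (x ^ n * r ^ (n * (n - 1)))" for n
  proof -
    have "Suc n * (Suc n - 1) = 2 * n + n * (n - 1)" by (cases n) auto
    thus ?thesis by (simp only: power_add power_Suc) (simp add: power_mult)
  qed
  have "r\<^sup>2 < 1" using assms by (simp add: power_less_one_iff)
  hence "(\<lambda>n. x * (r\<^sup>2) ^ n) \<longlonglongrightarrow> x * 0"
    by (intro tendsto_intros LIMSEQ_power_zero) auto
  hence "eventually (\<lambda>n. x * (r\<^sup>2) ^ n < 1 / 2) sequentially"
    by (rule order_tendstoD) auto
  then obtain N where N: "\<And>n. n \<ge> N \<Longrightarrow> x * (r\<^sup>2) ^ n < 1 / 2"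
    by (auto simp: eventually_sequentially)
  show ?thesis
  proof (rule summable_ratio_test)
    fix n assume "n \<ge> N"
    have "norm (x ^ Suc n * r ^ (Suc n * (Suc n - 1))) = x * (r\<^sup>2) ^ n * norm (x ^ n * r ^ (n * (n - 1)))"
      unfolding Suc using assms by (simp add: abs_mult)
    also have "\<dots> \<le> 1 / 2 * norm (x ^ n * r ^ (n * (n - 1)))"
      using N[OF \<open>n \<ge> N\<close>] by (intro mult_right_mono) auto
    finally show "norm (x ^ Suc n * r ^ (Suc n * (Suc n - 1))) \<le> 1 / 2 * norm (x ^ n * r ^ (n * (n - 1)))" .
  qed auto
qed

lemma summable_on_theta:
  fixes r x :: real
  assumes r: "0 < r" "r < 1" and x: "x > 0"
  shows "(\<lambda>s::int. x powi s * r powi (s * (s - 1))) summable_on UNIV"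
proof -
  define f where "f = (\<lambda>s::int. x powi s * r powi (s * (s - 1)))"
  have tri: "r powi (int n * (int n - 1)) = r ^ (n * (n - 1))" for n
  proof -
    have "int n * (int n - 1) = int (n * (n - 1))" by (cases n) (auto simp: algebra_simps)
    thus ?thesis by (simp only: power_int_of_nat)
  qed
  have nat: "(\<lambda>n. y ^ n * r ^ (n * (n - 1))) summable_on UNIV" if "y > 0" for y
    using summable_theta_nat[OF r that] that r by (intro summable_nonneg_imp_summable_on) auto
  have "(\<lambda>n. f (int n)) summable_on UNIV"
    using nat[OF x] by (simp add: f_def tri)
  moreover have "bij_betw int UNIV {0..}"
    by (rule bij_betwI[of _ _ _ nat]) auto
  ultimately have pos: "f summable_on {0..}"
    by (simp add: summable_on_reindex_bij_betw)
  \<comment> \<open>For s = -n-1 the exponent s (s - 1) equals n (n - 1) + 4n + 2, so the negative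
    half is the same series with x replaced by r^4 / x.\<close>
  have "(\<lambda>n. inverse x * r\<^sup>2 * ((inverse x * r ^ 4) ^ n * r ^ (n * (n - 1)))) summable_on UNIV"
    using r x by (intro summable_on_cmult_right nat) auto
  moreover have "inverse x * r\<^sup>2 * ((inverse x * r ^ 4) ^ n * r ^ (n * (n - 1))) = f (- int n - 1)" for n
  proof -
    have "x powi (- int n - 1) = inverse x ^ n * inverse x"
      using x by (simp add: power_int_diff power_int_minus power_inverse divide_inverse)
    moreover have "(- int n - 1) * (- int n - 1 - 1) = int n * (int n - 1) + int (4 * n) + 2"
      by (simp add: algebra_simps)
    hence "r powi ((- int n - 1) * (- int n - 1 - 1)) = r ^ (n * (n - 1)) * r ^ (4 * n) * r\<^sup>2"
      using r by (simp only: power_int_add tri power_int_of_nat power_int_numeral less_imp_neq[OF r(1), symmetric] simp_thms)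
    ultimately show ?thesis by (simp only: f_def) (simp add: power_mult power_mult_distrib)
  qed
  ultimately have "(\<lambda>n. f (- int n - 1)) summable_on UNIV" by simp
  moreover have "bij_betw (\<lambda>n. - int n - 1) UNIV {..<0}"
    by (rule bij_betwI[of _ _ _ "\<lambda>s. nat (- s - 1)"]) auto
  ultimately have "f summable_on {..<0}"
    using summable_on_reindex_bij_betw[of "\<lambda>n. - int n - 1" UNIV "{..<0}" f] by simp
  hence "f summable_on ({0..} \<union> {..<0})"
    using pos by (intro summable_on_Un_disjoint) auto
  also have "{0..} \<union> {..<0} = (UNIV :: int set)" by auto
  finally show ?thesis by (simp add: f_def)
qed

text \<open>Majorant for the sums over N_1: the number of inner terms grows polynomially in N_1,
  while the weight of N_1 decays geometrically.\<close>

lemma summable_poly_geometric: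
  fixes r :: real
  assumes r: "0 < r" "r < 1"
  shows "summable (\<lambda>n. real (Suc n) ^ m * r ^ n)"
proof -
  \<comment> \<open>The ratios of consecutive terms tend to \<open>r\<close>; any bound strictly
    between \<open>r\<close> and 1 serves, here the midpoint.\<close>
  define c where "c = (1 + r) / 2"
  have c: "r < c" "c < 1" using r by (auto simp: c_def)
  have "(\<lambda>n. (1 + inverse (real (Suc n))) ^ m * r) \<longlonglongrightarrow> (1 + 0) ^ m * r"
    by (intro tendsto_intros LIMSEQ_inverse_real_of_nat)
  hence "eventually (\<lambda>n. (1 + inverse (real (Suc n))) ^ m * r < c) sequentially"
    by (rule order_tendstoD) (use c in simp)
  then obtain N where N: "\<And>n. n \<ge> N \<Longrightarrow> (1 + inverse (real (Suc n))) ^ m * r < c"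
    by (auto simp: eventually_sequentially)
  show ?thesis
  proof (rule summable_ratio_test[OF c(2)])
    fix n assume "n \<ge> N"
    have "real (Suc (Suc n)) = (1 + inverse (real (Suc n))) * real (Suc n)"
      by (simp add: field_simps)
    hence "real (Suc (Suc n)) ^ m = (1 + inverse (real (Suc n))) ^ m * real (Suc n) ^ m"
      by (simp only: power_mult_distrib)
    hence "norm (real (Suc (Suc n)) ^ m * r ^ Suc n)
        = (1 + inverse (real (Suc n))) ^ m * r * norm (real (Suc n) ^ m * r ^ n)"
      using r by (simp add: abs_mult)
    also have "\<dots> \<le> c * norm (real (Suc n) ^ m * r ^ n)"
      using N[OF \<open>n \<ge> N\<close>] by (intro mult_right_mono) auto
    finally show "norm (real (Suc (Suc n)) ^ m * r ^ Suc n) \<le> c * norm (real (Suc n) ^ m * r ^ n)" .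
  qed
qed

section \<open>Sums over chains\<close>

text \<open>
  The tails \<open>n = N\<^sub>j \<ge> N\<^sub>j\<^sub>+\<^sub>1 \<ge> \<dots> \<ge> N\<^sub>k\<^sub>-\<^sub>1 \<ge> N\<^sub>k = 0\<close> of the summation tuples, with the entries before \<open>j\<close> set to \<open>0\<close>.
\<close>

definition pin :: "nat \<Rightarrow> nat \<Rightarrow> int \<Rightarrow> (nat \<Rightarrow> int) set" where
  "pin k j n = {N. N j = n \<and> (\<forall>l\<in>{j..<k}. 0 \<le> N (Suc l) \<and> N (Suc l) \<le> N l) \<and>
                   (\<forall>l. l < j \<or> k \<le> l \<longrightarrow> N l = 0)}"

text \<open>The value type is left open because two instances are needed: complex edge weights for
  the sum itself, and their norms for its majorant.\<close>

definition chain_sum :: "nat \<Rightarrow> (nat \<Rightarrow> int \<Rightarrow> int \<Rightarrow> 'a) \<Rightarrow> nat \<Rightarrow> int \<Rightarrow> 'a :: comm_semiring_1" where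
  "chain_sum k \<phi> j n = (\<Sum>N\<in>pin k j n. \<Prod>l\<in>{j..<k}. \<phi> l (N l) (N (Suc l)))"

lemma pin_self: "pin k k n = (if n = 0 then {\<lambda>_. 0} else {})"
proof -
  have "N \<in> pin k k n \<longleftrightarrow> n = 0 \<and> (\<forall>l. N l = 0)" for N
    unfolding pin_def using not_le by auto
  thus ?thesis by (auto simp: fun_eq_iff)
qed

lemma bij_betw_pin:
  assumes "j < k"
  shows "bij_betw (\<lambda>(r, M). M(j := n)) (SIGMA r:{0..n}. pin k (Suc j) r) (pin k j n)"
proof (rule bij_betwI[of _ _ _ "\<lambda>N. (N (Suc j), N(j := 0))"])
  show "(\<lambda>(r, M). M(j := n)) \<in> (SIGMA r:{0..n}. pin k (Suc j) r) \<rightarrow> pin k j n"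
  proof clarify
    fix r M assume r: "r \<in> {0..n}" and M: "M \<in> pin k (Suc j) r"
    have "0 \<le> (M(j := n)) (Suc l) \<and> (M(j := n)) (Suc l) \<le> (M(j := n)) l" if "l \<in> {j..<k}" for l
      using that r M by (cases "l = j") (auto simp: pin_def)
    thus "M(j := n) \<in> pin k j n"
      using M assms by (auto simp: pin_def)
  qed
  show "(\<lambda>N. (N (Suc j), N(j := 0))) \<in> pin k j n \<rightarrow> (SIGMA r:{0..n}. pin k (Suc j) r)"
  proof clarify
    fix N assume N: "N \<in> pin k j n"
    hence "N (Suc j) \<in> {0..n}" using assms by (auto simp: pin_def)
    moreover have "N(j := 0) \<in> pin k (Suc j) (N (Suc j))"
      using N by (auto simp: pin_def less_Suc_eq)
    ultimately show "N (Suc j) \<in> {0..n} \<and> N(j := 0) \<in> pin k (Suc j) (N (Suc j))" ..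
  qed
  show "(case (case x of (r, M) \<Rightarrow> M(j := n)) of N \<Rightarrow> (N (Suc j), N(j := 0))) = x"
    if "x \<in> (SIGMA r:{0..n}. pin k (Suc j) r)" for x
    using that by (auto simp: pin_def fun_eq_iff)
  show "(case (N (Suc j), N(j := 0)) of (r, M) \<Rightarrow> M(j := n)) = N" if "N \<in> pin k j n" for N
    using that by (simp add: pin_def fun_upd_idem_iff)
qed

lemma finite_pin: "j \<le> k \<Longrightarrow> finite (pin k j n)"
proof (induction j arbitrary: n rule: inc_induct)
  case (step j)
  have "finite (SIGMA r:{0..n}. pin k (Suc j) r)"
    using step.IH by auto
  thus ?case using bij_betw_finite[OF bij_betw_pin[OF step.hyps(2)]] by blast
qed (simp add: pin_self)

text \<open>The convention N_k = 0 makes the empty chain the delta at 0, which is exactly the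
  right-hand side of the unit Bailey pair.\<close>

lemma chain_sum_self: "chain_sum k \<phi> k n = (if n = 0 then 1 else 0)"
  by (simp add: chain_sum_def pin_self)

lemma chain_sum_rec:
  assumes "j < k"
  shows "chain_sum k \<phi> j n = (\<Sum>r\<in>{0..n}. \<phi> j n r * chain_sum k \<phi> (Suc j) r)"
proof -
  have "chain_sum k \<phi> j n = (\<Sum>(r, M)\<in>(SIGMA r:{0..n}. pin k (Suc j) r).
      \<Prod>l\<in>{j..<k}. \<phi> l ((M(j := n)) l) ((M(j := n)) (Suc l)))"
    unfolding chain_sum_def
    by (subst sum.reindex_bij_betw[OF bij_betw_pin[OF assms], symmetric]) (simp add: case_prod_unfold)
  also have "\<dots> = (\<Sum>(r, M)\<in>(SIGMA r:{0..n}. pin k (Suc j) r).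
      \<phi> j n r * (\<Prod>l\<in>{Suc j..<k}. \<phi> l (M l) (M (Suc l))))"
  proof (intro sum.cong refl, clarify)
    fix r M assume "M \<in> pin k (Suc j) r"
    hence "M (Suc j) = r" by (simp add: pin_def)
    thus "(\<Prod>l\<in>{j..<k}. \<phi> l ((M(j := n)) l) ((M(j := n)) (Suc l))) =
        \<phi> j n r * (\<Prod>l\<in>{Suc j..<k}. \<phi> l (M l) (M (Suc l)))"
      by (simp add: prod.atLeast_Suc_lessThan[OF assms])
  qed
  also have "\<dots> = (\<Sum>r\<in>{0..n}. \<phi> j n r * chain_sum k \<phi> (Suc j) r)"
    unfolding chain_sum_def sum_distrib_left
    using assms by (subst sum.Sigma) (auto simp: finite_pin)
  finally show ?thesis .
qed

text \<open>Each of the k - j steps offers at most n + 1 values and costs a factor of at most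
  \<open>K\<close>.\<close>

lemma chain_sum_le:
  fixes \<phi> :: "nat \<Rightarrow> int \<Rightarrow> int \<Rightarrow> real"
  assumes "j \<le> k" and "K \<ge> 0" and "n \<ge> 0"
    and "\<And>l a b. 0 \<le> b \<Longrightarrow> b \<le> a \<Longrightarrow> 0 \<le> \<phi> l a b \<and> \<phi> l a b \<le> K"
  shows "0 \<le> chain_sum k \<phi> j n \<and> chain_sum k \<phi> j n \<le> (K * (real_of_int n + 1)) ^ (k - j)"
  using assms(1,3)
proof (induction j arbitrary: n rule: inc_induct)
  case (step j)
  have "\<phi> j n r * chain_sum k \<phi> (Suc j) r \<le> K * (K * (real_of_int n + 1)) ^ (k - Suc j)"
    if "r \<in> {0..n}" for r
  proof (rule mult_mono)
    have "chain_sum k \<phi> (Suc j) r \<le> (K * (real_of_int r + 1)) ^ (k - Suc j)"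
      using step.IH[of r] that by auto
    also have "\<dots> \<le> (K * (real_of_int n + 1)) ^ (k - Suc j)"
      using that assms(2) by (intro power_mono mult_left_mono) auto
    finally show "chain_sum k \<phi> (Suc j) r \<le> (K * (real_of_int n + 1)) ^ (k - Suc j)" .
    show "\<phi> j n r \<le> K" "0 \<le> K" using assms(2) assms(4)[of r n j] that by simp_all
    show "0 \<le> chain_sum k \<phi> (Suc j) r" using step.IH[of r] that by simp
  qed
  hence "(\<Sum>r\<in>{0..n}. \<phi> j n r * chain_sum k \<phi> (Suc j) r)
      \<le> (\<Sum>r\<in>{0..n}. K * (K * (real_of_int n + 1)) ^ (k - Suc j))"
    by (rule sum_mono)
  also have "\<dots> = (K * (real_of_int n + 1)) ^ Suc (k - Suc j)"
    using step.prems by simp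
  also have "Suc (k - Suc j) = k - j" using step.hyps by simp
  finally have "chain_sum k \<phi> j n \<le> (K * (real_of_int n + 1)) ^ (k - j)"
    using step.hyps by (simp add: chain_sum_rec)
  moreover have "0 \<le> chain_sum k \<phi> j n"
    unfolding chain_sum_rec[OF step.hyps(2)]
  proof (rule sum_nonneg)
    fix r assume "r \<in> {0..n}"
    thus "0 \<le> \<phi> j n r * chain_sum k \<phi> (Suc j) r"
      using assms(4)[of r n j] step.IH[of r] by simp
  qed
  ultimately show ?case by blast
qed (auto simp: chain_sum_self)

text \<open>Fibring the tuples over N_1 turns the outer sum into one over \<open>nat\<close> with
  finite fibres. In \<open>pin\<close>, nonnegativity of N_(k-1) is the inequality against N_k =
  0.\<close>

lemma bij_betw_pin_tuples:
  assumes "k \<ge> 1"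
  shows "bij_betw snd (SIGMA n:UNIV. pin k 1 (int n)) (tuples k)"
proof (rule bij_betwI[of _ _ _ "\<lambda>N. (nat (N 1), N)"])
  show "snd \<in> (SIGMA n:UNIV. pin k 1 (int n)) \<rightarrow> tuples k"
  proof clarsimp
    fix n :: nat and N assume N: "N \<in> pin k (Suc 0) (int n)"
    have "0 \<le> N j" if "1 \<le> j" for j
    proof (cases "j = 1")
      case True
      thus ?thesis using N by (simp add: pin_def)
    next
      case False
      define l where "l = j - 1"
      have "j = Suc l" "1 \<le> l" using that False by (auto simp: l_def)
      thus ?thesis using N by (cases "l < k") (auto simp: pin_def)
    qed
    thus "N \<in> tuples k"
      using N by (auto simp: tuples_def pin_def not_less not_le)
  qed
  show "(\<lambda>N. (nat (N 1), N)) \<in> tuples k \<rightarrow> (SIGMA n:UNIV. pin k 1 (int n))"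
  proof (rule funcsetI)
    fix N assume N: "N \<in> tuples k"
    have nonneg: "0 \<le> N j" for j
      using N by (cases "j \<in> {1..<k}") (auto simp: tuples_def)
    moreover have "N (Suc l) \<le> N l" if "1 \<le> l" "l < k" for l
    proof (cases "Suc l < k")
      case True
      thus ?thesis using N that by (auto simp: tuples_def)
    next
      case False
      hence "N (Suc l) = 0" using N by (auto simp: tuples_def)
      thus ?thesis using nonneg by simp
    qed
    ultimately show "(nat (N 1), N) \<in> (SIGMA n:UNIV. pin k 1 (int n))"
      using N by (auto simp: pin_def tuples_def)
  qed
  show "(nat (snd x 1), snd x) = x" if "x \<in> (SIGMA n:UNIV. pin k 1 (int n))" for x
    using that by (cases x) (simp add: pin_def)
qed simp

section \<open>Bailey pairs\<close>

text \<open>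
  The value is \<open>1 / (q\<^sup>2; q\<^sup>2)\<^sub>n\<close>. Being \<open>0\<close> for \<open>n < 0\<close>, it lets all finite sums below range over
  all integers, so that shifts and reflections of the index cost nothing.
\<close>

definition rqfac :: "complex \<Rightarrow> int \<Rightarrow> complex" where
  "rqfac q n = (if n < 0 then 0 else inverse (\<Prod>j<nat n. 1 - q ^ (2 * Suc j)))"

locale qbase =
  fixes q :: complex
  assumes q_nz: "q \<noteq> 0" and q_lt: "norm q < 1"
begin

abbreviation "R \<equiv> rqfac q"

text \<open>\<open>D\<close> and \<open>E\<close> are the Bailey kernels relative to a = 1 and a = p
  = q^2, the latter without its constant factor 1 - p.\<close>

definition D :: "int \<Rightarrow> int \<Rightarrow> complex" where
  "D n s = R (n - s) * R (n + s)"

definition E :: "int \<Rightarrow> int \<Rightarrow> complex" where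
  "E n s = R (n - s) * R (n + s + 1)"

lemma powi_mult: "q powi a * q powi b = q powi (a + b)"
  by (simp add: power_int_add q_nz)

lemma powi_mult_left: "q powi a * (q powi b * c) = q powi (a + b) * c"
  by (simp add: power_int_add q_nz)

lemma q2_lt: "norm (q\<^sup>2) < 1"
  using q_lt by (simp add: norm_power power_less_one_iff)

lemma power_neq_1: "m > 0 \<Longrightarrow> q ^ m \<noteq> 1"
proof
  assume "m > 0" "q ^ m = 1"
  hence "norm q ^ m = 1" by (metis norm_one norm_power)
  moreover have "norm q ^ m < 1"
    using q_lt \<open>m > 0\<close> by (simp add: power_less_one_iff)
  ultimately show False by simp
qed

lemma R_neg [simp]: "n < 0 \<Longrightarrow> R n = 0"
  by (simp add: rqfac_def)

lemma R_0 [simp]: "R 0 = 1"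
  by (simp add: rqfac_def)

text \<open>No case distinction on the sign is left to the user: at n = 0 the factor 1 - q^0
  vanishes together with \<open>R (- 1)\<close>.\<close>

lemma R_pred: "R (n - 1) = (1 - q powi (2 * n)) * R n"
proof -
  consider "n < 0" | "n = 0" | m where "n = int (Suc m)"
    by (metis not0_implies_Suc nonneg_int_cases not_less of_nat_0)
  thus ?thesis
  proof cases
    case (3 m)
    have "1 - q ^ (2 * Suc m) \<noteq> 0" using power_neq_1[of "2 * Suc m"] by simp
    moreover have "q powi (2 * n) = q ^ (2 * Suc m)"
      unfolding 3 by (metis of_nat_mult of_nat_numeral power_int_of_nat)
    moreover have "nat n = Suc m" "nat (n - 1) = m" using 3 by auto
    ultimately show ?thesis using 3
      by (simp add: rqfac_def del: power_Suc mult_Suc_right)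
  qed auto
qed

lemma R_step: "R n = (1 - q powi (2 * n + 2)) * R (n + 1)"
  using R_pred[of "n + 1"] by (simp add: algebra_simps)

lemma D_neg: "r < 0 \<Longrightarrow> D r s = 0"
  by (cases "r - s < 0") (auto simp: D_def)

lemma E_neg: "r < 0 \<Longrightarrow> E r s = 0"
  by (cases "r - s < 0") (auto simp: E_def)

lemma D_uminus: "D n (- s) = D n s"
  by (simp add: D_def)

lemma E_reflect: "E n (- s - 1) = E n s"
  by (simp add: E_def algebra_simps)

lemma D_eq_0: "\<bar>s\<bar> > n \<Longrightarrow> D n s = 0"
  by (cases "n - s < 0") (auto simp: D_def)

lemma E_eq_0: "s \<notin> {- n - 1..n} \<Longrightarrow> E n s = 0"
  by (cases "n - s < 0") (auto simp: E_def)

lemma D_conv_E: "D n s = (1 - q powi (2 * n + 2 * s + 2)) * E n s"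
  unfolding D_def E_def R_step[of "n + s"] by (simp add: algebra_simps)

lemma has_sum_E_support:
  "((\<lambda>s. c s * E n s) has_sum (\<Sum>s\<in>{- n - 1..n}. c s * E n s)) UNIV"
  by (rule has_sum_finite_neutralI[of "{- n - 1..n}"]) (use E_eq_0 in auto)

text \<open>
  Writing \<open>F N a\<close> for the sum times \<open>(q\<^sup>2; q\<^sup>2)\<^sub>N\<close>, the \<open>q\<close>-Pascal rule gives \<open>F (N + 1) a = F N (a + 1)\<close>.
\<close>

lemma vandermonde:
  "((\<lambda>j. q powi (2 * (j * (j + a))) * R (N - j) * R j * R (j + a)) has_sum R N * R (N + a)) UNIV"
proof (cases "N < 0")
  case True
  have "q powi (2 * (j * (j + a))) * R (N - j) * R j * R (j + a) = 0" for j
    using True by (cases "j < 0") auto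
  hence "((\<lambda>j. q powi (2 * (j * (j + a))) * R (N - j) * R j * R (j + a)) has_sum 0) UNIV"
    by (rule has_sum_0)
  thus ?thesis using True by simp
next
  case False
  then obtain m where "N = int m" by (metis nonneg_int_cases not_less)
  moreover have "((\<lambda>j. q powi (2 * (j * (j + a))) * R (int m - j) * R j * R (j + a))
      has_sum R (int m) * R (int m + a)) UNIV"
  proof (induction m arbitrary: a)
    case 0
    have "R (- j) * R j = 0" if "j \<noteq> 0" for j
      using that by (cases "j < 0") auto
    thus ?case
      by (intro has_sum_finite_neutralI[of "{0}"]) auto
  next
    case (Suc m)
    define t where "t = (\<lambda>j. q powi (2 * (j * (j + (a + 1)))) * R (int m - j) * R j * R (j + (a + 1)))"
    \<comment> \<open>Adding \<open>v (j - 1) - v j\<close> does not change the sum of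
      \<open>t\<close>, since \<open>v\<close> and its shift both sum to \<open>A\<close>. Termwise,
      subtracting \<open>v j\<close> lowers \<open>R (j + a + 1)\<close> to
      \<open>R (j + a)\<close>, and the shifted term supplies the other half of the Pascal
      rule.\<close>
    define v where "v = (\<lambda>j. q powi (2 * (j + 1 + a)) * t j)"
    have t: "(t has_sum R (int m) * R (int m + (a + 1))) UNIV"
      unfolding t_def by (rule Suc.IH)
    define A where "A = (\<Sum>j\<in>{0..int m}. v j)"
    have "v j = 0" if "j \<notin> {0..int m}" for j
      using that unfolding v_def t_def by (cases "j < 0") auto
    hence v: "(v has_sum A) UNIV"
      unfolding A_def by (intro has_sum_finite_neutralI) auto
    have v': "((\<lambda>j. v (j - 1)) has_sum A) UNIV"
      using has_sum_reindex_bij_witness[of UNIV "\<lambda>j. j - 1" "\<lambda>j. j + 1" UNIV "\<lambda>j. v (j - 1)" v A A] v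
      by simp
    have "((\<lambda>j. t j + - v j + v (j - 1)) has_sum R (int m) * R (int m + (a + 1)) + - A + A) UNIV"
      by (intro has_sum_add t v' has_sum_uminusI v)
    moreover have "R (int m) * R (int m + (a + 1)) + - A + A =
        (1 - q powi (2 * int m + 2)) * (R (int (Suc m)) * R (int (Suc m) + a))"
      unfolding R_step[of "int m"] by (simp add: algebra_simps)
    moreover have "t j + - v j + v (j - 1) = (1 - q powi (2 * int m + 2)) *
        (q powi (2 * (j * (j + a))) * R (int (Suc m) - j) * R j * R (j + a))" for j
    proof -
      have 1: "t j + - v j = q powi (2 * (j * (j + a))) * q powi (2 * j) * R (int m - j) * R j * R (j + a)"
        unfolding t_def v_def R_step[of "j + a"]
        by (simp add: powi_mult powi_mult_left algebra_simps)
      have 2: "v (j - 1) = q powi (2 * (j * (j + a))) * R (int m + 1 - j) * R (j - 1) * R (j + a)"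
        by (simp add: t_def v_def powi_mult_left powi_mult algebra_simps)
      have 3: "R (int m - j) = (1 - q powi (2 * (int m + 1 - j))) * R (int m + 1 - j)"
        using R_step[of "int m - j"] by (simp add: algebra_simps)
      have 4: "q powi (2 * int m + 2) = q powi (2 * j) * q powi (2 * (int m + 1 - j))"
        by (simp add: powi_mult algebra_simps)
      \<comment> \<open>After removing common factors: p^j (1 - p^(m+1-j)) + (1 - p^j) = 1 -
        p^(m+1).\<close>
      show ?thesis unfolding 1 2 3 R_pred[of j] 4
        by (simp add: algebra_simps)
    qed
    ultimately have *: "((\<lambda>j. (1 - q powi (2 * int m + 2)) *
        (q powi (2 * (j * (j + a))) * R (int (Suc m) - j) * R j * R (j + a)))
        has_sum (1 - q powi (2 * int m + 2)) * (R (int (Suc m)) * R (int (Suc m) + a))) UNIV"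
      by simp
    have "q powi (2 * int m + 2) = q ^ (2 * m + 2)"
      by (metis of_nat_add of_nat_mult of_nat_numeral power_int_of_nat)
    hence "1 - q powi (2 * int m + 2) \<noteq> 0"
      using power_neq_1[of "2 * m + 2"] by simp
    from has_sum_cmult_right_cancel[OF this *] show ?case .
  qed
  ultimately show ?thesis by simp
qed

text \<open>Bailey's lemma at the level of the kernel. With r = s + j one has r^2 = s^2 + j (j +
  2s), so this is \<open>vandermonde\<close> for N = n - s and a = 2s.\<close>

lemma vandermonde_D: "(\<Sum>r\<in>{0..n}. R (n - r) * q powi (2 * r\<^sup>2) * D r s) = q powi (2 * s\<^sup>2) * D n s"
proof -
  have "((\<lambda>j. q powi (2 * s\<^sup>2) * (q powi (2 * (j * (j + 2 * s))) * R (n - s - j) * R j * R (j + 2 * s)))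
      has_sum q powi (2 * s\<^sup>2) * (R (n - s) * R (n - s + 2 * s))) UNIV"
    by (intro has_sum_cmult_right vandermonde)
  also have "?this \<longleftrightarrow> ((\<lambda>r. R (n - r) * q powi (2 * r\<^sup>2) * D r s) has_sum q powi (2 * s\<^sup>2) * D n s) UNIV"
    by (rule has_sum_reindex_bij_witness[of _ "\<lambda>r. r - s" "\<lambda>j. j + s"])
       (auto simp: D_def powi_mult powi_mult_left algebra_simps power2_eq_square)
  also have "\<dots> \<longleftrightarrow> ((\<lambda>r. R (n - r) * q powi (2 * r\<^sup>2) * D r s) has_sum q powi (2 * s\<^sup>2) * D n s) {0..n}"
    by (rule has_sum_cong_neutral) (auto simp: D_neg not_le)
  finally show ?thesis by (simp add: has_sum_finite_iff)
qed

text \<open>Here r^2 + r = s^2 + s + j (j + 2s + 1) for r = s + j, whence a = 2s + 1.\<close>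

lemma vandermonde_E:
  "(\<Sum>r\<in>{0..n}. R (n - r) * q powi (2 * (r\<^sup>2 + r)) * E r s) = q powi (2 * (s\<^sup>2 + s)) * E n s"
proof -
  have "((\<lambda>j. q powi (2 * (s\<^sup>2 + s)) * (q powi (2 * (j * (j + (2 * s + 1)))) * R (n - s - j) * R j * R (j + (2 * s + 1))))
      has_sum q powi (2 * (s\<^sup>2 + s)) * (R (n - s) * R (n - s + (2 * s + 1)))) UNIV"
    by (intro has_sum_cmult_right vandermonde)
  also have "?this \<longleftrightarrow> ((\<lambda>r. R (n - r) * q powi (2 * (r\<^sup>2 + r)) * E r s) has_sum q powi (2 * (s\<^sup>2 + s)) * E n s) UNIV"
    by (rule has_sum_reindex_bij_witness[of _ "\<lambda>r. r - s" "\<lambda>j. j + s"])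
       (auto simp: E_def powi_mult powi_mult_left algebra_simps power2_eq_square)
  also have "\<dots> \<longleftrightarrow> ((\<lambda>r. R (n - r) * q powi (2 * (r\<^sup>2 + r)) * E r s) has_sum q powi (2 * (s\<^sup>2 + s)) * E n s) {0..n}"
    by (rule has_sum_cong_neutral) (auto simp: E_neg not_le)
  finally show ?thesis by (simp add: has_sum_finite_iff)
qed

lemma bailey_step_D:
  assumes "\<And>r. ((\<lambda>s. c s * D r s) has_sum b r) UNIV"
  shows "((\<lambda>s. c s * q powi (2 * s\<^sup>2) * D n s) has_sum
          (\<Sum>r\<in>{0..n}. R (n - r) * q powi (2 * r\<^sup>2) * b r)) UNIV"
proof -
  have "((\<lambda>s. \<Sum>r\<in>{0..n}. R (n - r) * q powi (2 * r\<^sup>2) * (c s * D r s)) has_sum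
          (\<Sum>r\<in>{0..n}. R (n - r) * q powi (2 * r\<^sup>2) * b r)) UNIV"
    by (intro has_sum_sum has_sum_cmult_right assms) auto
  moreover have "(\<Sum>r\<in>{0..n}. R (n - r) * q powi (2 * r\<^sup>2) * (c s * D r s)) =
      c s * q powi (2 * s\<^sup>2) * D n s" for s
    unfolding mult.assoc[of "c s"] vandermonde_D[symmetric] sum_distrib_left
    by (simp add: mult_ac)
  ultimately show ?thesis by simp
qed

lemma bailey_step_E:
  assumes "\<And>r. ((\<lambda>s. c s * E r s) has_sum b r) UNIV"
  shows "((\<lambda>s. c s * q powi (2 * (s\<^sup>2 + s)) * E n s) has_sum
          (\<Sum>r\<in>{0..n}. R (n - r) * q powi (2 * (r\<^sup>2 + r)) * b r)) UNIV"
proof -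
  have "((\<lambda>s. \<Sum>r\<in>{0..n}. R (n - r) * q powi (2 * (r\<^sup>2 + r)) * (c s * E r s)) has_sum
          (\<Sum>r\<in>{0..n}. R (n - r) * q powi (2 * (r\<^sup>2 + r)) * b r)) UNIV"
    by (intro has_sum_sum has_sum_cmult_right assms) auto
  moreover have "(\<Sum>r\<in>{0..n}. R (n - r) * q powi (2 * (r\<^sup>2 + r)) * (c s * E r s)) =
      c s * q powi (2 * (s\<^sup>2 + s)) * E n s" for s
    unfolding mult.assoc[of "c s"] vandermonde_E[symmetric] sum_distrib_left
    by (simp add: mult_ac)
  ultimately show ?thesis by simp
qed

definition c :: "nat \<Rightarrow> int \<Rightarrow> complex" where
  "c m s = (- 1) powi s * q powi (s * (s - 1) + 2 * int m * (s\<^sup>2 + s))"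

text \<open>Folding s with -s-1 therefore gives (1 - p^(2s+1)) times \<open>c m s\<close>; for m = 0
  these are, up to the constant 1 - p, the classical unit pair coefficients relative to a =
  p.\<close>

lemma c_reflect: "c m (- s - 1) = - (q powi (2 * (2 * s + 1)) * c m s)"
proof -
  have "(- 1) powi (- s - 1) = - ((- 1) powi s :: complex)"
    by (simp add: power_int_diff power_int_minus_one_minus)
  thus ?thesis
    by (simp add: c_def powi_mult_left powi_mult power2_eq_square algebra_simps)
qed

lemma c_Suc: "c (Suc m) s = c m s * q powi (2 * (s\<^sup>2 + s))"
  by (simp add: c_def powi_mult mult.assoc algebra_simps)

lemma has_sum_reflect:
  fixes f :: "int \<Rightarrow> complex"
  shows "((\<lambda>s. f (- s - 1)) has_sum b) UNIV \<longleftrightarrow> (f has_sum b) UNIV"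
  by (rule has_sum_reindex_bij_witness[of _ "\<lambda>s. - s - 1" "\<lambda>s. - s - 1"]) auto

lemma has_sum_E_antisymmetric:
  assumes "\<And>s. g (- s - 1) = - g s"
  shows "((\<lambda>s. g s * E n s) has_sum 0) UNIV"
proof -
  obtain A where A: "((\<lambda>s. g s * E n s) has_sum A) UNIV"
    using has_sum_E_support by blast
  hence "((\<lambda>s. g (- s - 1) * E n (- s - 1)) has_sum A) UNIV"
    by (subst has_sum_reflect[of "\<lambda>s. g s * E n s"])
  hence "((\<lambda>s. - (g s * E n s)) has_sum A) UNIV"
    by (simp add: assms E_reflect)
  moreover have "((\<lambda>s. - (g s * E n s)) has_sum - A) UNIV"
    using A by (rule has_sum_uminusI)
  ultimately have "A = - A" by (rule has_sum_unique)
  thus ?thesis using A by simp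
qed

text \<open>The factor p^s balances the p^(2s+1) of \<open>c_reflect\<close>, leaving an
  antisymmetric coefficient. This vanishing removes the middle terms both in the unit pair and in
  the passage to a = 1.\<close>

lemma has_sum_c_q_E: "((\<lambda>s. q powi (2 * s) * c m s * E n s) has_sum 0) UNIV"
proof (rule has_sum_E_antisymmetric)
  fix s
  show "q powi (2 * (- s - 1)) * c m (- s - 1) = - (q powi (2 * s) * c m s)"
    unfolding c_reflect by (simp add: powi_mult_left powi_mult algebra_simps)
qed

text \<open>
  For \<open>n > 0\<close> the forward difference of \<open>c 0 s * D n s\<close> in \<open>s\<close> sums to \<open>0\<close>; up to antisymmetric terms it is
  \<open>(q\<^sup>2\<^sup>n - 1) c 0 s * E n s\<close>.
\<close>

lemma unit_bailey_pair: "((\<lambda>s. c 0 s * E n s) has_sum (if n = 0 then 1 else 0)) UNIV"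
proof -
  consider "n < 0" | "n = 0" | "n > 0" by linarith
  thus ?thesis
  proof cases
    case 1
    thus ?thesis by (simp add: E_neg)
  next
    case 2
    \<comment> \<open>For n = 0 only s = 0 and s = -1 survive; they contribute \<open>R 1\<close>
      and - q^2 \<open>R 1\<close>.\<close>
    have "R 1 * (1 - q\<^sup>2) = 1"
      using R_pred[of 1] by (simp add: mult.commute)
    hence "c 0 (- 1) * E 0 (- 1) + c 0 0 * E 0 0 = 1"
      by (simp add: c_def E_def algebra_simps)
    moreover have "{- 1..0::int} = {- 1, 0}" by auto
    ultimately show ?thesis
      using has_sum_E_support[of "c 0" 0] 2 by simp
  next
    case 3
    obtain A where A: "((\<lambda>s. c 0 s * E n s) has_sum A) UNIV"
      using has_sum_E_support by blast
    define T where "T = (\<lambda>s. c 0 s * D n s)"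
    have T: "(T has_sum (\<Sum>s\<in>{- n..n}. T s)) UNIV"
      by (rule has_sum_finite_neutralI[of "{- n..n}"]) (auto simp: T_def D_eq_0)
    hence "((\<lambda>s. T (s + 1)) has_sum (\<Sum>s\<in>{- n..n}. T s)) UNIV"
      using has_sum_reindex_bij_witness[of UNIV "\<lambda>j. j + 1" "\<lambda>j. j - 1" UNIV "\<lambda>j. T (j + 1)" T]
      by simp
    from has_sum_add[OF this has_sum_uminusI[OF T]]
    have "((\<lambda>s. T (s + 1) + - T s) has_sum 0) UNIV" by simp
    moreover have "T (s + 1) + - T s = (q powi (2 * n) - 1) * (c 0 s * E n s)
        + (q powi (2 * n + 2) - 1) * (q powi (2 * s) * c 0 s * E n s)" for s
    proof -
      have 1: "c 0 (s + 1) = - (q powi (2 * s) * c 0 s)"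
        by (simp add: c_def powi_mult_left powi_mult power_int_add algebra_simps)
      have 2: "D n (s + 1) = (1 - q powi (2 * (n - s))) * E n s"
        using R_pred[of "n - s"] unfolding D_def E_def diff_diff_eq by (simp add: add.assoc)
      show ?thesis unfolding T_def 1 2 D_conv_E[of n s]
        by (simp add: powi_mult_left powi_mult algebra_simps)
    qed
    ultimately have "((\<lambda>s. (q powi (2 * n) - 1) * (c 0 s * E n s)
        + (q powi (2 * n + 2) - 1) * (q powi (2 * s) * c 0 s * E n s)) has_sum 0) UNIV"
      by simp
    moreover have "((\<lambda>s. (q powi (2 * n) - 1) * (c 0 s * E n s)
        + (q powi (2 * n + 2) - 1) * (q powi (2 * s) * c 0 s * E n s)) has_sum
          ((q powi (2 * n) - 1) * A + (q powi (2 * n + 2) - 1) * 0)) UNIV"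
      by (intro has_sum_add has_sum_cmult_right A has_sum_c_q_E)
    ultimately have "(q powi (2 * n) - 1) * A = 0"
      using has_sum_unique by fastforce
    moreover have "q powi (2 * n) = q ^ (2 * nat n)"
      using 3 by (simp add: power_int_def nat_mult_distrib)
    hence "q powi (2 * n) \<noteq> 1" using power_neq_1[of "2 * nat n"] 3 by simp
    ultimately show ?thesis using A 3 by simp
  qed
qed

text \<open>By \<open>D_conv_E\<close> the coefficient of \<open>E n s\<close> is
  \<open>c m s\<close> times (1 + p^s) (1 - p^(n+s+1)) = 1 + (1 - p^(n+1)) p^s - p^(n+2s+1). The
  middle term sums to 0, and reflection turns the last one into p^n times the first.\<close>

lemma bailey_E_imp_D:
  assumes b: "((\<lambda>s. c m s * E n s) has_sum b) UNIV"
  shows "((\<lambda>s. (1 + q powi (2 * s)) * c m s * D n s) has_sum (1 + q powi (2 * n)) * b) UNIV"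
proof -
  have "((\<lambda>s. c m (- s - 1) * E n (- s - 1)) has_sum b) UNIV"
    using b by (subst has_sum_reflect[of "\<lambda>s. c m s * E n s"])
  hence b': "((\<lambda>s. - (q powi (2 * (2 * s + 1)) * c m s * E n s)) has_sum b) UNIV"
    by (simp add: c_reflect E_reflect)
  have "((\<lambda>s. c m s * E n s + (1 - q powi (2 * n + 2)) * (q powi (2 * s) * c m s * E n s)
      + q powi (2 * n) * - (q powi (2 * (2 * s + 1)) * c m s * E n s)) has_sum
      b + (1 - q powi (2 * n + 2)) * 0 + q powi (2 * n) * b) UNIV"
    by (intro has_sum_add has_sum_cmult_right b b' has_sum_c_q_E)
  moreover have "c m s * E n s + (1 - q powi (2 * n + 2)) * (q powi (2 * s) * c m s * E n s)
      + q powi (2 * n) * - (q powi (2 * (2 * s + 1)) * c m s * E n s)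
      = (1 + q powi (2 * s)) * c m s * D n s" for s
    unfolding D_conv_E by (simp add: powi_mult_left powi_mult algebra_simps)
  ultimately show ?thesis by (simp add: algebra_simps)
qed

section \<open>The outermost sum\<close>

lemma R_LIMSEQ: "(\<lambda>n. R (int n)) \<longlonglongrightarrow> 1 / qpoch_inf (q\<^sup>2) (q\<^sup>2)"
proof -
  have "(\<lambda>n. inverse (\<Prod>j<n. 1 - q\<^sup>2 * (q\<^sup>2) ^ j)) \<longlonglongrightarrow> inverse (qpoch_inf (q\<^sup>2) (q\<^sup>2))"
    by (intro tendsto_inverse qpoch_inf_LIMSEQ q2_lt qpoch_inf_nonzero_of_norm_less)
  moreover have "R (int n) = inverse (\<Prod>j<n. 1 - q\<^sup>2 * (q\<^sup>2) ^ j)" for n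
    by (simp add: rqfac_def power_mult power2_eq_square mult.assoc)
  ultimately show ?thesis by (simp add: inverse_eq_divide)
qed

lemma R_bounded: "\<exists>C\<ge>1. \<forall>n. norm (R n) \<le> C"
proof -
  have "Bseq (\<lambda>n. R (int n))"
    using R_LIMSEQ by (intro convergent_imp_Bseq) (auto simp: convergent_def)
  then obtain C where C: "C > 0" "\<And>n. norm (R (int n)) \<le> C"
    by (auto elim: BseqE)
  have "norm (R n) \<le> C" for n
    using C(1) C(2)[of "nat n"] by (cases "n < 0") auto
  moreover have "C \<ge> 1" using C(2)[of 0] by simp
  ultimately show ?thesis by blast
qed

text \<open>Euler's sum. By \<open>R_pred\<close> the series satisfies f (x p) = (1 - x) f x;
  iterating this drives the argument to 0 and builds up the product.\<close>

lemma euler_sum: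
  assumes z: "norm z < 1"
  shows "((\<lambda>j. z ^ j * R (int j)) has_sum 1 / qpoch_inf z (q\<^sup>2)) UNIV"
proof -
  obtain C where C: "C \<ge> 1" "\<And>n. norm (R n) \<le> C" using R_bounded by blast
  define f where "f = (\<lambda>x. \<Sum>\<^sub>\<infinity>j. x ^ j * R (int j))"
  have geo: "(\<lambda>j. norm z ^ j * C) summable_on UNIV"
    using z C(1) by (intro summable_nonneg_imp_summable_on summable_mult2 summable_geometric) auto
  have bound: "norm (x ^ j * R (int j)) \<le> norm z ^ j * C" if "norm x \<le> norm z" for x j
    using that C by (auto simp: norm_mult norm_power intro!: mult_mono power_mono)
  have f: "((\<lambda>j. x ^ j * R (int j)) has_sum f x) UNIV" if "norm x \<le> norm z" for x
    unfolding f_def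
    by (rule has_sum_infsum[OF summable_on_dominated[OF geo bound[OF that]]])
  have shrink: "norm (z * (q\<^sup>2) ^ n) \<le> norm z" for n
    using q2_lt by (simp add: norm_mult mult_left_le power_le_one norm_power)
  have step: "f (x * q\<^sup>2) = (1 - x) * f x" if x: "norm x \<le> norm z" for x
  proof -
    have le: "norm (x * q\<^sup>2) \<le> norm z"
      using x q2_lt by (simp add: norm_mult) (meson mult_left_le norm_ge_zero less_imp_le order_trans)
    have "((\<lambda>j. x * (x ^ j * R (int j))) has_sum x * f x) UNIV"
      by (intro has_sum_cmult_right f x)
    also have "?this \<longleftrightarrow> ((\<lambda>j. x ^ j * R (int j - 1)) has_sum x * f x) {1..}"
      by (rule has_sum_reindex_bij_witness[of _ "\<lambda>j. j - 1" Suc]) (auto simp: mult.assoc)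
    also have "\<dots> \<longleftrightarrow> ((\<lambda>j. x ^ j * R (int j - 1)) has_sum x * f x) UNIV"
      by (rule has_sum_cong_neutral) (auto simp: not_le)
    finally have "((\<lambda>j. x ^ j * R (int j) + - (x ^ j * R (int j - 1))) has_sum f x + - (x * f x)) UNIV"
      by (intro has_sum_add f x has_sum_uminusI)
    moreover have "x ^ j * R (int j) + - (x ^ j * R (int j - 1)) = (x * q\<^sup>2) ^ j * R (int j)" for j
    proof -
      have "q powi (2 * int j) = (q\<^sup>2) ^ j"
        by (simp add: power_int_mult)
      thus ?thesis by (simp add: R_pred[of "int j"] power_mult_distrib algebra_simps)
    qed
    ultimately have "((\<lambda>j. (x * q\<^sup>2) ^ j * R (int j)) has_sum f x + - (x * f x)) UNIV"
      by simp
    from has_sum_unique[OF this f[OF le]] show ?thesis by (simp add: algebra_simps)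
  qed
  have iter: "f (z * (q\<^sup>2) ^ n) = (\<Prod>j<n. 1 - z * (q\<^sup>2) ^ j) * f z" for n
  proof (induction n)
    case (Suc n)
    thus ?case using step[OF shrink[of n]] by (simp add: mult_ac)
  qed auto
  \<comment> \<open>As the argument tends to 0 only the term j = 0 survives, so the limit of the
    iterated equation is 1.\<close>
  have "((\<lambda>j. if j = 0 then 1 else 0) has_sum qpoch_inf z (q\<^sup>2) * f z) (UNIV :: nat set)"
  proof (rule has_sum_tannery[where h = "\<lambda>j. norm z ^ j * C" and G = sequentially
        and S = "\<lambda>n. f (z * (q\<^sup>2) ^ n)" and f = "\<lambda>n j. (z * (q\<^sup>2) ^ n) ^ j * R (int j)"])
    show "(\<lambda>n. (z * (q\<^sup>2) ^ n) ^ j * R (int j)) \<longlonglongrightarrow> (if j = 0 then 1 else 0)" for j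
    proof (cases "j = 0")
      case False
      have "(\<lambda>n. (z * (q\<^sup>2) ^ n) ^ j * R (int j)) \<longlonglongrightarrow> (z * 0) ^ j * R (int j)"
        by (intro tendsto_intros LIMSEQ_power_zero q2_lt)
      thus ?thesis using False by (simp add: power_0_left)
    qed auto
    show "(\<lambda>n. f (z * (q\<^sup>2) ^ n)) \<longlonglongrightarrow> qpoch_inf z (q\<^sup>2) * f z"
      unfolding iter by (intro tendsto_mult tendsto_const qpoch_inf_LIMSEQ q2_lt)
  qed (use geo bound[OF shrink] f[OF shrink] in auto)
  moreover have "((\<lambda>j. if j = 0 then 1 else 0) has_sum (1::complex)) (UNIV :: nat set)"
    by (rule has_sum_finite_neutralI[of "{0}"]) auto
  ultimately have "qpoch_inf z (q\<^sup>2) * f z = 1"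
    by (rule has_sum_unique)
  hence "f z = 1 / qpoch_inf z (q\<^sup>2)"
    by (metis nonzero_mult_div_cancel_left mult_zero_left zero_neq_one)
  thus ?thesis using f[of z] by simp
qed

text \<open>This is (-1; q)_2n / 2. The halving cancels the leading factor 1 + q^0 for n > 0; for n
  = 0 it is the value 1/2 of (-q^2; q^2)_(-1), which occurs at N_1 = 0.\<close>

definition v :: "nat \<Rightarrow> complex" where
  "v n = (\<Prod>j<n. (1 + q ^ (2 * j)) * (1 + q ^ (2 * j + 1))) / 2"

text \<open>The two numerator factorials together with q^(2 N_1^2), as \<open>qpoch_weight\<close>
  shows.\<close>

definition w :: "nat \<Rightarrow> complex" where
  "w n = v n * q ^ n"

lemma v_LIMSEQ: "v \<longlonglongrightarrow> qpoch_inf (- q) q"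
proof -
  have "(\<lambda>n. (\<Prod>j<n. 1 - (- 1) * (q\<^sup>2) ^ j) * (\<Prod>j<n. 1 - (- q) * (q\<^sup>2) ^ j) / 2)
      \<longlonglongrightarrow> qpoch_inf (- 1) (q\<^sup>2) * qpoch_inf (- q) (q\<^sup>2) / 2"
    by (intro tendsto_intros qpoch_inf_LIMSEQ q2_lt) auto
  moreover have "(\<lambda>n. (\<Prod>j<n. 1 - (- 1) * (q\<^sup>2) ^ j) * (\<Prod>j<n. 1 - (- q) * (q\<^sup>2) ^ j) / 2) = v"
    by (rule ext) (simp add: v_def power_mult prod.distrib)
  moreover have "qpoch_inf (- 1) (q\<^sup>2) = 2 * qpoch_inf (- q * q) (q\<^sup>2)"
    using qpoch_inf_split[OF q2_lt, of "- 1" 1] by (simp add: power2_eq_square)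
  ultimately show ?thesis
    using qpoch_inf_even_odd[OF q_lt, of "- q"] by (simp only:) (simp add: mult_ac)
qed

lemma w_bounded: "\<exists>W>0. \<forall>n. norm (v n) \<le> W \<and> norm (w n) \<le> W * norm q ^ n"
proof -
  have "Bseq v"
    using v_LIMSEQ by (intro convergent_imp_Bseq) (auto simp: convergent_def)
  then obtain W where "W > 0" "\<And>n. norm (v n) \<le> W"
    by (auto elim: BseqE)
  thus ?thesis
    by (auto simp: w_def norm_mult norm_power intro!: exI[of _ W] mult_right_mono)
qed

lemma w_Suc: "w (Suc n) = q * (1 + q ^ (2 * n)) * (1 + q * q ^ (2 * n)) * w n"
  by (simp add: w_def v_def)

definition S :: "nat \<Rightarrow> complex" where
  "S s = (\<Sum>\<^sub>\<infinity>n. w n * D (int n) (int s))"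

text \<open>
  The recurrence in \<open>s\<close> comes from the telescoping certificate
  \<open>T n = - (1 - q\<^sup>2\<^sup>s\<^sup>+\<^sup>1) w n / ((q\<^sup>2; q\<^sup>2)\<^sub>n\<^sub>-\<^sub>s\<^sub>-\<^sub>1 (q\<^sup>2; q\<^sup>2)\<^sub>n\<^sub>+\<^sub>s)\<close>.
\<close>

lemma S_has_sum: "((\<lambda>n. w n * D (int n) (int s)) has_sum S s) UNIV"
  and S_eq_S_0: "(1 + q ^ (2 * s)) * S s = 2 * q ^ s * S 0"
proof -
  obtain C where C: "C \<ge> 1" "\<And>n. norm (R n) \<le> C" using R_bounded by blast
  obtain W where W: "W > 0" "\<And>n. norm (w n) \<le> W * norm q ^ n" using w_bounded by blast
  have bound: "norm (w n * (R a * R b)) \<le> W * norm q ^ n * (C * C)" for n a b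
    unfolding norm_mult using C W by (intro mult_mono) auto
  have geo: "(\<lambda>n. W * norm q ^ n * (C * C)) summable_on UNIV"
    using q_lt C(1) W(1)
    by (intro summable_nonneg_imp_summable_on summable_mult2 summable_mult summable_geometric) auto
  show S: "((\<lambda>n. w n * D (int n) (int s)) has_sum S s) UNIV" for s
    unfolding S_def D_def
    by (rule has_sum_infsum[OF summable_on_dominated[OF geo bound]])
  have step: "(1 + q ^ (2 * Suc s)) * S (Suc s) = q * (1 + q ^ (2 * s)) * S s" for s
  proof -
    define T where "T = (\<lambda>n. - (1 - q * q ^ (2 * s)) * (w n * (R (int n - int s - 1) * R (int n + int s))))"
    have "(\<lambda>n. W * norm q ^ n * (C * C)) \<longlonglongrightarrow> W * 0 * (C * C)"
      using q_lt by (intro tendsto_intros LIMSEQ_power_zero) auto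
    hence "(\<lambda>n. w n * (R (int n - int s - 1) * R (int n + int s))) \<longlonglongrightarrow> 0"
      by (intro Lim_null_comparison[OF always_eventually[OF allI[OF bound]]]) simp
    hence "T \<longlonglongrightarrow> - (1 - q * q ^ (2 * s)) * 0"
      unfolding T_def by (intro tendsto_intros)
    hence "(\<lambda>n. T (Suc n) - T n) sums (0 - T 0)"
      by (intro telescope_sums) auto
    \<comment> \<open>\<open>R (- s - 1)\<close> vanishes, so the lower end leaves no boundary
      term.\<close>
    moreover have "T 0 = 0" by (simp add: T_def)
    moreover have "T (Suc n) - T n = (1 + q ^ (2 * Suc s)) * (w n * D (int n) (int (Suc s)))
        - q * (1 + q ^ (2 * s)) * (w n * D (int n) (int s))" for n
    proof -
      \<comment> \<open>Every term is a multiple of \<open>w n * U\<close>; what remains is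
        \<open>key\<close>, a rational identity in \<open>q\<close>, \<open>X\<close> and
        \<open>P\<close>.\<close>
      define U where "U = R (int n - int s) * R (int n + int s + 1)"
      define X where "X = q ^ (2 * n)"
      define P where "P = q ^ (2 * s)"
      have P: "P \<noteq> 0" by (simp add: P_def q_nz)
      have XP: "q powi (2 * (int n - int s)) = X / P"
      proof -
        have "q powi (2 * (int n - int s)) = q powi (int (2 * n) - int (2 * s))"
          by (simp add: algebra_simps)
        also have "\<dots> = X / P"
          by (simp only: power_int_diff power_int_of_nat X_def P_def q_nz simp_thms)
        finally show ?thesis .
      qed
      have XP': "q powi (2 * (int n + int s) + 2) = X * P * q\<^sup>2"
      proof -
        have "q powi (2 * (int n + int s) + 2) = q powi (int (2 * n) + int (2 * s) + int 2)"
          by (simp add: algebra_simps)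
        also have "\<dots> = X * P * q\<^sup>2"
          by (simp only: power_int_add power_int_of_nat X_def P_def q_nz simp_thms)
        finally show ?thesis .
      qed
      have r1: "R (int n - int s - 1) = (1 - X / P) * R (int n - int s)"
        using R_pred[of "int n - int s"] unfolding XP .
      have r2: "R (int n + int s) = (1 - X * P * q\<^sup>2) * R (int n + int s + 1)"
        using R_step[of "int n + int s"] unfolding XP' .
      have D1: "D (int n) (int (Suc s)) = (1 - X / P) * U"
        unfolding U_def mult.assoc[symmetric] r1[symmetric] by (simp add: D_def algebra_simps)
      have D2: "D (int n) (int s) = (1 - X * P * q\<^sup>2) * U"
        unfolding U_def D_def r2 by simp
      have T1: "T (Suc n) = - (1 - q * P) * (q * (1 + X) * (1 + q * X) * w n * U)"
        by (simp add: T_def w_Suc U_def X_def P_def algebra_simps)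
      have T2: "T n = - (1 - q * P) * (w n * ((1 - X / P) * (1 - X * P * q\<^sup>2) * U))"
        unfolding T_def r1 r2 U_def P_def by (simp add: mult_ac)
      have key: "- (1 - q * P) * (q * (1 + X) * (1 + q * X) - (1 - X / P) * (1 - X * P * q\<^sup>2))
          = (1 + q\<^sup>2 * P) * (1 - X / P) - q * (1 + P) * (1 - X * P * q\<^sup>2)"
        using P by (simp add: field_simps) (simp add: algebra_simps power2_eq_square)
      have "T (Suc n) - T n = (- (1 - q * P) * (q * (1 + X) * (1 + q * X) - (1 - X / P) * (1 - X * P * q\<^sup>2))) * (w n * U)"
      proof -
        have "- a * (b * w n * U) - - a * (w n * (y * z * U)) = (- a * (b - y * z)) * (w n * U)" for a b y z
          by (simp add: algebra_simps)
        thus ?thesis unfolding T1 T2 .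
      qed
      also have "\<dots> = (1 + q\<^sup>2 * P) * (w n * ((1 - X / P) * U)) - q * (1 + P) * (w n * ((1 - X * P * q\<^sup>2) * U))"
      proof -
        have "(a * y - b * z) * (w n * U) = a * (w n * (y * U)) - b * (w n * (z * U))" for a b y z
          by (simp add: algebra_simps)
        thus ?thesis unfolding key .
      qed
      also have "q\<^sup>2 * P = q ^ (2 * Suc s)"
        by (simp add: P_def power2_eq_square)
      finally show ?thesis unfolding D1 D2 P_def .
    qed
    ultimately have "(\<lambda>n. (1 + q ^ (2 * Suc s)) * (w n * D (int n) (int (Suc s)))
        - q * (1 + q ^ (2 * s)) * (w n * D (int n) (int s))) sums 0"
      by simp
    moreover have "(\<lambda>n. (1 + q ^ (2 * Suc s)) * (w n * D (int n) (int (Suc s)))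
        - q * (1 + q ^ (2 * s)) * (w n * D (int n) (int s))) sums
        ((1 + q ^ (2 * Suc s)) * S (Suc s) - q * (1 + q ^ (2 * s)) * S s)"
      by (intro sums_diff sums_mult has_sum_imp_sums S)
    ultimately show ?thesis
      using sums_unique2 by fastforce
  qed
  show "(1 + q ^ (2 * s)) * S s = 2 * q ^ s * S 0"
  proof (induction s)
    case (Suc s)
    have "(1 + q ^ (2 * Suc s)) * S (Suc s) = q * ((1 + q ^ (2 * s)) * S s)"
      using step by (simp only: mult.assoc)
    thus ?case unfolding Suc.IH by simp
  qed auto
qed

lemma one_plus_power_nonzero: "m > 0 \<Longrightarrow> 1 + q ^ m \<noteq> 0"
proof
  assume "m > 0" "1 + q ^ m = 0"
  hence "q ^ m = - 1" by (simp add: add_eq_0_iff)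
  hence "q ^ (m * 2) = 1" by (simp add: power_mult)
  thus False using power_neq_1[of "m * 2"] \<open>m > 0\<close> by simp
qed

text \<open>
  By the recurrence \<open>(1 + q\<^sup>2\<^sup>s) S s / q\<^sup>s\<close> is constant; its value is found by letting \<open>s\<close> tend to infinity.
\<close>

lemma w_D_has_sum:
  "((\<lambda>n. w n * D (int n) s) has_sum
     (qpoch_inf (- q) q / qpoch_inf q q * q powi s / (1 + q powi (2 * s)))) UNIV"
proof -
  obtain C where C: "C \<ge> 1" "\<And>n. norm (R n) \<le> C" using R_bounded by blast
  obtain W where W: "W > 0" "\<And>n. norm (v n) \<le> W" using w_bounded by blast
  have nz: "1 + q ^ (2 * s) \<noteq> 0" for s
    using one_plus_power_nonzero[of "2 * s"] by (cases "s = 0") auto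
  have S_eq: "S s = 2 * S 0 * q ^ s / (1 + q ^ (2 * s))" for s
    using S_eq_S_0[of s] nz[of s] by (simp add: field_simps)
  \<comment> \<open>Substituting n = s + j and dividing by q^s, the factors \<open>v (j + s)\<close>
    and \<open>R (j + 2 * s)\<close> converge, and Euler's sum at z = q is left. On the other side
    \<open>S s / q ^ s\<close> is 2 \<open>S 0\<close> / (1 + q^(2s)), which tends to 2
    \<open>S 0\<close>.\<close>
  have "((\<lambda>j. qpoch_inf (- q) q * q ^ j * (R (int j) * (1 / qpoch_inf (q\<^sup>2) (q\<^sup>2)))) has_sum 2 * S 0) UNIV"
  proof (rule has_sum_tannery[where h = "\<lambda>j. W * norm q ^ j * (C * C)" and G = sequentially
        and S = "\<lambda>s. S s / q ^ s" and f = "\<lambda>s j. v (j + s) * q ^ j * (R (int j) * R (int (j + 2 * s)))"])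
    show "norm (v (j + s) * q ^ j * (R (int j) * R (int (j + 2 * s)))) \<le> W * norm q ^ j * (C * C)" for s j
      unfolding norm_mult norm_power using C W by (intro mult_mono) auto
    show "(\<lambda>j. W * norm q ^ j * (C * C)) summable_on UNIV"
      using q_lt C(1) W(1)
      by (intro summable_nonneg_imp_summable_on summable_mult2 summable_mult summable_geometric) auto
    show "(\<lambda>s. v (j + s) * q ^ j * (R (int j) * R (int (j + 2 * s))))
        \<longlonglongrightarrow> qpoch_inf (- q) q * q ^ j * (R (int j) * (1 / qpoch_inf (q\<^sup>2) (q\<^sup>2)))" for j
    proof (intro tendsto_mult tendsto_const)
      show "(\<lambda>s. v (j + s)) \<longlonglongrightarrow> qpoch_inf (- q) q"
        using LIMSEQ_ignore_initial_segment[OF v_LIMSEQ, of j] by (simp add: add.commute)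
      show "(\<lambda>s. R (int (j + 2 * s))) \<longlonglongrightarrow> 1 / qpoch_inf (q\<^sup>2) (q\<^sup>2)"
        using LIMSEQ_subseq_LIMSEQ[OF R_LIMSEQ, of "\<lambda>s. j + 2 * s"]
        by (auto simp: strict_mono_def o_def)
    qed
    show "((\<lambda>j. v (j + s) * q ^ j * (R (int j) * R (int (j + 2 * s)))) has_sum S s / q ^ s) UNIV" for s
    proof -
      have "((\<lambda>n. w n * D (int n) (int s) / q ^ s) has_sum S s / q ^ s) UNIV"
        by (intro has_sum_divide_const S_has_sum)
      also have "?this \<longleftrightarrow> ((\<lambda>n. w n * D (int n) (int s) / q ^ s) has_sum S s / q ^ s) {s..}"
        by (rule has_sum_cong_neutral) (auto simp: D_eq_0)
      also have "\<dots> \<longleftrightarrow> ?thesis"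
        by (rule has_sum_reindex_bij_witness[of _ "\<lambda>j. j + s" "\<lambda>n. n - s"])
           (auto simp: w_def D_def power_diff q_nz of_nat_diff field_simps)
      finally show ?thesis .
    qed
    have "(\<lambda>s. 2 * S 0 / (1 + (q\<^sup>2) ^ s)) \<longlonglongrightarrow> 2 * S 0 / (1 + 0)"
      by (intro tendsto_intros LIMSEQ_power_zero q2_lt) auto
    moreover have "S s / q ^ s = 2 * S 0 / (1 + (q\<^sup>2) ^ s)" for s
      by (simp add: S_eq[of s] q_nz power_mult)
    ultimately show "(\<lambda>s. S s / q ^ s) \<longlonglongrightarrow> 2 * S 0" by simp
  qed auto
  moreover have "((\<lambda>j. qpoch_inf (- q) q * (1 / qpoch_inf (q\<^sup>2) (q\<^sup>2)) * (q ^ j * R (int j)))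
      has_sum qpoch_inf (- q) q * (1 / qpoch_inf (q\<^sup>2) (q\<^sup>2)) * (1 / qpoch_inf q (q\<^sup>2))) UNIV"
    by (intro has_sum_cmult_right euler_sum q_lt)
  hence "((\<lambda>j. qpoch_inf (- q) q * q ^ j * (R (int j) * (1 / qpoch_inf (q\<^sup>2) (q\<^sup>2))))
      has_sum qpoch_inf (- q) q * (1 / qpoch_inf (q\<^sup>2) (q\<^sup>2)) * (1 / qpoch_inf q (q\<^sup>2))) UNIV"
    by (simp add: mult_ac)
  ultimately have "2 * S 0 = qpoch_inf (- q) q * (1 / qpoch_inf (q\<^sup>2) (q\<^sup>2)) * (1 / qpoch_inf q (q\<^sup>2))"
    by (rule has_sum_unique)
  also have "\<dots> = qpoch_inf (- q) q / qpoch_inf q q"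
    using qpoch_inf_even_odd[OF q_lt, of q] by (simp add: power2_eq_square mult_ac)
  finally have S0: "2 * S 0 = qpoch_inf (- q) q / qpoch_inf q q" .
  have nonneg: "((\<lambda>n. w n * D (int n) (int s)) has_sum
     (qpoch_inf (- q) q / qpoch_inf q q * q powi int s / (1 + q powi (2 * int s)))) UNIV" for s
  proof -
    have "q powi (2 * int s) = q ^ (2 * s)"
      by (metis of_nat_mult of_nat_numeral power_int_of_nat)
    thus ?thesis using S_has_sum[of s] by (simp add: S_eq[of s] S0)
  qed
  show ?thesis
  proof (cases "s \<ge> 0")
    case True
    thus ?thesis using nonneg[of "nat s"] by simp
  next
    case False
    \<comment> \<open>The claim is even in s: so is \<open>D\<close>, and the right-hand side
      contains 1 / (q^s + q^(-s)).\<close>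
    have eq: "q powi (- s) / (1 + q powi (2 * - s)) = q powi s / (1 + q powi (2 * s))"
    proof -
      have "q powi (2 * s) = q powi s * q powi s" "q powi (2 * - s) = q powi (- s) * q powi (- s)"
        by (simp_all add: powi_mult)
      moreover have "q powi s \<noteq> 0" by (simp add: q_nz)
      ultimately show ?thesis by (simp add: power_int_minus field_simps)
    qed
    have "int (nat (- s)) = - s" using False by simp
    with nonneg[of "nat (- s)"] show ?thesis
      by (simp only: D_uminus eq times_divide_eq_right[symmetric])
  qed
qed

section \<open>The triple product\<close>

text \<open>With X = q^(2n), the next two factors (1 - z X) (1 - q^2 X / z) mix the coefficients at
  s - 1, s and s + 1. The induction step says that this mixture is proportional to
  \<open>D (n + 1) s\<close>, the constant being the ratio of \<open>R (2 * n)\<close> to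
  \<open>R (2 * n + 2)\<close>.\<close>

lemma finite_jacobi_triple_product:
  assumes z: "z \<noteq> 0"
  shows "((\<lambda>s. (- z) powi s * q powi (s * (s - 1)) * D (int n) s) has_sum
    ((\<Prod>j<n. (1 - z * q ^ (2 * j)) * (1 - q\<^sup>2 / z * q ^ (2 * j))) * R (int (2 * n)))) UNIV"
proof (induction n)
  case 0
  show ?case
    by (rule has_sum_finite_neutralI[of "{0}"]) (auto simp: D_eq_0, simp add: D_def)
next
  case (Suc n)
  define e where "e = (\<lambda>s. (- z) powi s * q powi (s * (s - 1)))"
  define A where "A = (\<Prod>j<n. (1 - z * q ^ (2 * j)) * (1 - q\<^sup>2 / z * q ^ (2 * j))) * R (int (2 * n))"
  define X where "X = q ^ (2 * n)"
  have X: "q powi (2 * int n) = X"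
    unfolding X_def by (metis of_nat_mult of_nat_numeral power_int_of_nat)
  have A: "((\<lambda>s. e s * D (int n) s) has_sum A) UNIV"
    using Suc.IH by (simp add: e_def A_def)
  have A1: "((\<lambda>s. e (s - 1) * D (int n) (s - 1)) has_sum A) UNIV"
    using has_sum_reindex_bij_witness[of UNIV "\<lambda>j. j - 1" "\<lambda>j. j + 1" UNIV "\<lambda>s. e (s - 1) * D (int n) (s - 1)" "\<lambda>s. e s * D (int n) s" A A] A
    by simp
  have A2: "((\<lambda>s. e (s + 1) * D (int n) (s + 1)) has_sum A) UNIV"
    using has_sum_reindex_bij_witness[of UNIV "\<lambda>j. j + 1" "\<lambda>j. j - 1" UNIV "\<lambda>s. e (s + 1) * D (int n) (s + 1)" "\<lambda>s. e s * D (int n) s" A A] A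
    by simp
  have e_shift: "e (s + 1) = - z * q powi (2 * s) * e s" for s
    using z by (simp add: e_def power_int_add powi_mult powi_mult_left algebra_simps)
  have e1: "- z * X * e (s - 1) = q powi (2 * (int n - s + 1)) * e s" for s
  proof -
    have "q powi (2 * (int n - s + 1)) * e s = q powi (2 * (int n - s + 1)) * q powi (2 * (s - 1)) * (- z * e (s - 1))"
      using e_shift[of "s - 1"] by simp
    thus ?thesis by (simp add: powi_mult X)
  qed
  have e2: "- (X * q\<^sup>2 / z) * e (s + 1) = q powi (2 * (int n + s + 1)) * e s" for s
  proof -
    have "q powi (2 * (int n + s + 1)) = X * q\<^sup>2 * q powi (2 * s)"
      by (simp add: X[symmetric] power_int_add q_nz distrib_left)
    thus ?thesis unfolding e_shift using z by (simp add: field_simps)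
  qed
  have "((\<lambda>s. (1 + X * X * q\<^sup>2) * (e s * D (int n) s)
      + (- z * X) * (e (s - 1) * D (int n) (s - 1)) + (- (X * q\<^sup>2 / z)) * (e (s + 1) * D (int n) (s + 1)))
      has_sum (1 + X * X * q\<^sup>2) * A + (- z * X) * A + (- (X * q\<^sup>2 / z)) * A) UNIV"
    by (intro has_sum_add has_sum_cmult_right A A1 A2)
  also have "(1 + X * X * q\<^sup>2) * A + (- z * X) * A + (- (X * q\<^sup>2 / z)) * A = (1 - z * X) * (1 - q\<^sup>2 / z * X) * A"
    using z by (simp add: field_simps)
  also have "(\<lambda>s. (1 + X * X * q\<^sup>2) * (e s * D (int n) s)
      + (- z * X) * (e (s - 1) * D (int n) (s - 1)) + (- (X * q\<^sup>2 / z)) * (e (s + 1) * D (int n) (s + 1)))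
    = (\<lambda>s. (1 - X * X * q\<^sup>2) * (1 - X * X * q ^ 4) * (e s * D (int (Suc n)) s))"
  proof
    fix s
    \<comment> \<open>\<open>1 - a\<close> and \<open>1 - b\<close> are the factors that raise the
      indices of \<open>R (n - s)\<close> and \<open>R (n + s)\<close> by one. By \<open>e1\<close>
      and \<open>e2\<close> the variable \<open>z\<close> disappears, and \<open>key\<close> is an
      identity in \<open>a\<close>, \<open>b\<close> and \<open>q\<close> alone.\<close>
    define a where "a = q powi (2 * (int n - s + 1))"
    define b where "b = q powi (2 * (int n + s + 1))"
    define V where "V = R (int n - s + 1) * R (int n + s + 1)"
    have ab: "a * b = X * X * q ^ 4"
    proof -
      have "a * b = q powi (2 * int n + 2 * int n + 4)"
        by (simp add: a_def b_def powi_mult)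
      thus ?thesis by (simp only: power_int_add q_nz simp_thms X power_int_numeral)
    qed
    have q2: "q powi (- 2) = 1 / q\<^sup>2"
      by (simp add: power_int_minus inverse_eq_divide)
    have a': "q powi (2 * (int n - s)) = a / q\<^sup>2"
      using powi_mult[of "2 * (int n - s + 1)" "- 2"] by (simp add: a_def q2 algebra_simps)
    have b': "q powi (2 * (int n + s)) = b / q\<^sup>2"
      using powi_mult[of "2 * (int n + s + 1)" "- 2"] by (simp add: b_def q2 algebra_simps)
    have ra: "R (int n - s) = (1 - a) * R (int n - s + 1)"
      using R_step[of "int n - s"] by (simp add: a_def algebra_simps)
    have rb: "R (int n + s) = (1 - b) * R (int n + s + 1)"
      using R_step[of "int n + s"] by (simp add: b_def algebra_simps)
    have ra': "R (int n - s - 1) = (1 - a / q\<^sup>2) * R (int n - s)"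
      using R_pred[of "int n - s"] unfolding a' .
    have rb': "R (int n + s - 1) = (1 - b / q\<^sup>2) * R (int n + s)"
      using R_pred[of "int n + s"] unfolding b' .
    have D0: "D (int n) s = (1 - a) * (1 - b) * V"
      unfolding D_def ra rb V_def by (simp add: mult_ac)
    have D1: "D (int n) (s - 1) = (1 - b / q\<^sup>2) * (1 - b) * V"
    proof -
      have "D (int n) (s - 1) = R (int n - s + 1) * R (int n + s - 1)"
        by (simp add: D_def algebra_simps)
      thus ?thesis unfolding rb' rb V_def by (simp add: mult_ac)
    qed
    have D2: "D (int n) (s + 1) = (1 - a / q\<^sup>2) * (1 - a) * V"
    proof -
      have "D (int n) (s + 1) = R (int n - s - 1) * R (int n + s + 1)"
        by (simp add: D_def algebra_simps)
      thus ?thesis unfolding ra' ra V_def by (simp add: mult_ac)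
    qed
    have D3: "D (int (Suc n)) s = V"
      by (simp add: D_def V_def algebra_simps)
    have XX: "X * X * q\<^sup>2 = a * b / q\<^sup>2"
      unfolding ab using q_nz by (simp add: field_simps flip: power_add)
    have key: "(1 + a * b / q\<^sup>2) * ((1 - a) * (1 - b)) + a * ((1 - b / q\<^sup>2) * (1 - b)) + b * ((1 - a / q\<^sup>2) * (1 - a))
        = (1 - a * b / q\<^sup>2) * (1 - a * b)"
      using q_nz by (simp add: field_simps)
    have "(1 + X * X * q\<^sup>2) * (e s * D (int n) s)
      + (- z * X) * (e (s - 1) * D (int n) (s - 1)) + (- (X * q\<^sup>2 / z)) * (e (s + 1) * D (int n) (s + 1))
      = (1 + X * X * q\<^sup>2) * (e s * D (int n) s) + (- z * X * e (s - 1)) * D (int n) (s - 1)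
        + (- (X * q\<^sup>2 / z) * e (s + 1)) * D (int n) (s + 1)"
      by (simp only: mult.assoc)
    also have "\<dots> = (1 + a * b / q\<^sup>2) * (e s * ((1 - a) * (1 - b) * V)) + a * e s * ((1 - b / q\<^sup>2) * (1 - b) * V)
        + b * e s * ((1 - a / q\<^sup>2) * (1 - a) * V)"
      unfolding e1 e2 XX D0 D1 D2 a_def[symmetric] b_def[symmetric] ..
    also have "\<dots> = ((1 + a * b / q\<^sup>2) * ((1 - a) * (1 - b)) + a * ((1 - b / q\<^sup>2) * (1 - b)) + b * ((1 - a / q\<^sup>2) * (1 - a))) * (e s * V)"
      by (simp only: distrib_left distrib_right mult_ac)
    also have "\<dots> = (1 - X * X * q\<^sup>2) * (1 - X * X * q ^ 4) * (e s * D (int (Suc n)) s)"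
      unfolding key D3 XX ab[symmetric] ..
    finally show "(1 + X * X * q\<^sup>2) * (e s * D (int n) s)
      + (- z * X) * (e (s - 1) * D (int n) (s - 1)) + (- (X * q\<^sup>2 / z)) * (e (s + 1) * D (int n) (s + 1))
      = (1 - X * X * q\<^sup>2) * (1 - X * X * q ^ 4) * (e s * D (int (Suc n)) s)" .
  qed
  also have "(1 - z * X) * (1 - q\<^sup>2 / z * X) * A = (1 - X * X * q\<^sup>2) * (1 - X * X * q ^ 4) *
     ((\<Prod>j<Suc n. (1 - z * q ^ (2 * j)) * (1 - q\<^sup>2 / z * q ^ (2 * j))) * R (int (2 * Suc n)))"
  proof -
    have "q powi (2 * int n + 2 * int n + 2) = X * X * q\<^sup>2" "q powi (2 * int n + 2 * int n + 4) = X * X * q ^ 4"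
      by (simp_all only: power_int_add q_nz simp_thms X power_int_numeral)
    hence "q powi (2 * (2 * int n) + 2) = X * X * q\<^sup>2" "q powi (2 * (2 * int n + 1) + 2) = X * X * q ^ 4"
      by (simp_all add: algebra_simps)
    hence "R (int (2 * n)) = (1 - X * X * q\<^sup>2) * (1 - X * X * q ^ 4) * R (int (2 * Suc n))"
      using R_step[of "2 * int n"] R_step[of "2 * int n + 1"] by (simp add: add.assoc add.commute[of 2])
    thus ?thesis by (simp add: A_def X_def mult_ac)
  qed
  finally have *: "((\<lambda>s. (1 - X * X * q\<^sup>2) * (1 - X * X * q ^ 4) * (e s * D (int (Suc n)) s)) has_sum
     (1 - X * X * q\<^sup>2) * (1 - X * X * q ^ 4) *
     ((\<Prod>j<Suc n. (1 - z * q ^ (2 * j)) * (1 - q\<^sup>2 / z * q ^ (2 * j))) * R (int (2 * Suc n)))) UNIV" .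
  have "X * X * q\<^sup>2 = q ^ (4 * n + 2)" "X * X * q ^ 4 = q ^ (4 * n + 4)"
    by (simp_all add: X_def flip: power_add)
  hence "(1 - X * X * q\<^sup>2) * (1 - X * X * q ^ 4) \<noteq> 0"
    using power_neq_1[of "4 * n + 2"] power_neq_1[of "4 * n + 4"] by (simp del: power_add)
  from has_sum_cmult_right_cancel[OF this *] show ?case
    unfolding e_def .
qed

lemma jacobi_triple_product:
  assumes z: "z \<noteq> 0"
  shows "((\<lambda>s. (- z) powi s * q powi (s * (s - 1))) has_sum
    qpoch_inf z (q\<^sup>2) * qpoch_inf (q\<^sup>2 / z) (q\<^sup>2) * qpoch_inf (q\<^sup>2) (q\<^sup>2)) UNIV"
proof -
  define L where "L = qpoch_inf (q\<^sup>2) (q\<^sup>2)"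
  have L: "L \<noteq> 0" unfolding L_def by (intro qpoch_inf_nonzero_of_norm_less q2_lt)
  obtain C where C: "C \<ge> 1" "\<And>n. norm (R n) \<le> C" using R_bounded by blast
  have R_shift: "(\<lambda>n. R (int n + a)) \<longlonglongrightarrow> 1 / L" for a
  proof -
    have "filterlim (\<lambda>n. nat (int n + a)) sequentially sequentially"
    proof (rule filterlim_at_top_mono)
      show "filterlim (\<lambda>n. n - nat \<bar>a\<bar>) sequentially sequentially"
        by (rule filterlim_minus_const_nat_at_top)
      show "\<forall>\<^sub>F n in sequentially. n - nat \<bar>a\<bar> \<le> nat (int n + a)"
        by (intro always_eventually allI) linarith
    qed
    from filterlim_compose[OF R_LIMSEQ this]
    have "(\<lambda>n. R (int (nat (int n + a)))) \<longlonglongrightarrow> 1 / L" by (simp add: L_def)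
    moreover have "\<forall>\<^sub>F n in sequentially. R (int (nat (int n + a))) = R (int n + a)"
      using eventually_ge_at_top[of "nat \<bar>a\<bar>"] by eventually_elim auto
    ultimately show ?thesis by (rule Lim_transform_eventually)
  qed
  have "((\<lambda>s. (- z) powi s * q powi (s * (s - 1)) * (1 / L * (1 / L))) has_sum
      qpoch_inf z (q\<^sup>2) * qpoch_inf (q\<^sup>2 / z) (q\<^sup>2) * (1 / L)) UNIV"
  proof (rule has_sum_tannery[where G = sequentially
        and h = "\<lambda>s. norm z powi s * norm q powi (s * (s - 1)) * (C * C)"
        and f = "\<lambda>n s. (- z) powi s * q powi (s * (s - 1)) * D (int n) s"])
    show "norm ((- z) powi s * q powi (s * (s - 1)) * D (int n) s)
        \<le> norm z powi s * norm q powi (s * (s - 1)) * (C * C)" for n s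
      unfolding D_def norm_mult norm_power_int norm_minus_cancel
      using C by (intro mult_mono mult_nonneg_nonneg) auto
    show "(\<lambda>s. norm z powi s * norm q powi (s * (s - 1)) * (C * C)) summable_on UNIV"
      using q_nz q_lt z by (intro summable_on_cmult_left summable_on_theta) auto
    show "(\<lambda>n. (- z) powi s * q powi (s * (s - 1)) * D (int n) s)
        \<longlonglongrightarrow> (- z) powi s * q powi (s * (s - 1)) * (1 / L * (1 / L))" for s
      unfolding D_def using R_shift[of "- s"] R_shift[of s]
      by (intro tendsto_mult tendsto_const) auto
    have "(\<lambda>n. R (int (2 * n))) \<longlonglongrightarrow> 1 / L"
      using LIMSEQ_subseq_LIMSEQ[OF R_LIMSEQ, of "\<lambda>n. 2 * n"]
      by (auto simp: strict_mono_def o_def L_def)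
    moreover have "(\<Prod>j<n. (1 - z * q ^ (2 * j)) * (1 - q\<^sup>2 / z * q ^ (2 * j)))
        = (\<Prod>j<n. 1 - z * (q\<^sup>2) ^ j) * (\<Prod>j<n. 1 - q\<^sup>2 / z * (q\<^sup>2) ^ j)" for n
      by (simp add: prod.distrib power_mult)
    ultimately show "(\<lambda>n. (\<Prod>j<n. (1 - z * q ^ (2 * j)) * (1 - q\<^sup>2 / z * q ^ (2 * j))) * R (int (2 * n)))
        \<longlonglongrightarrow> qpoch_inf z (q\<^sup>2) * qpoch_inf (q\<^sup>2 / z) (q\<^sup>2) * (1 / L)"
      by (simp only:) (intro tendsto_mult qpoch_inf_LIMSEQ q2_lt)
  qed (use finite_jacobi_triple_product[OF z] in auto)
  \<comment> \<open>The kernel contributes 1 / L^2 on the left and \<open>R (2 * n)\<close>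
    contributes 1 / L on the right; the surviving \<open>L\<close> is the third product.\<close>
  from has_sum_cmult_left[OF this, of "L * L"] show ?thesis
    using L by (simp add: L_def mult_ac)
qed

section \<open>The multiple sum\<close>

lemma powi_sum: "finite A \<Longrightarrow> q powi (\<Sum>x\<in>A. f x) = (\<Prod>x\<in>A. q powi f x)"
  by (induction A rule: finite_induct) (auto simp: power_int_add q_nz)

lemma norm_powi_le_1: "a \<ge> 0 \<Longrightarrow> norm (q powi a) \<le> 1"
  using q_lt by (simp add: power_int_def norm_power power_le_one)

lemma q2_powi: "(q\<^sup>2) powi m = q powi (2 * m)"
  by (simp add: power_int_mult)

lemma one_plus_powi_nonzero: "1 + q powi (2 * s) \<noteq> 0"
proof (cases "s \<ge> 0")
  case True
  hence "q powi (2 * s) = q ^ (2 * nat s)"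
    by (simp add: power_int_def nat_mult_distrib)
  thus ?thesis using one_plus_power_nonzero[of "2 * nat s"] True by (cases "s = 0") auto
next
  case False
  hence "nat (- (2 * s)) = 2 * nat (- s)" by auto
  hence "q powi (2 * s) = inverse (q ^ (2 * nat (- s)))"
    using False by (simp add: power_int_def power_inverse)
  hence "1 + q powi (2 * s) = (1 + q ^ (2 * nat (- s))) / q ^ (2 * nat (- s))"
    using q_nz by (simp add: add_divide_distrib inverse_eq_divide)
  thus ?thesis using one_plus_power_nonzero[of "2 * nat (- s)"] False q_nz by simp
qed

lemma qpoch_q2: "m \<ge> 0 \<Longrightarrow> qpoch (q\<^sup>2) (q\<^sup>2) m = inverse (R m)"
proof -
  assume "m \<ge> 0"
  then obtain n where m: "m = int n" by (metis nonneg_int_cases)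
  have "norm (q\<^sup>2 * (q\<^sup>2) ^ n) = norm (q\<^sup>2) ^ Suc n"
    by (simp add: norm_mult norm_power)
  hence "norm (q\<^sup>2 * (q\<^sup>2) ^ n) < 1"
    using q2_lt by (simp add: power_less_one_iff del: power_Suc)
  hence "qpoch_inf (q\<^sup>2 * (q\<^sup>2) ^ n) (q\<^sup>2) \<noteq> 0"
    by (intro qpoch_inf_nonzero_of_norm_less q2_lt)
  hence "qpoch (q\<^sup>2) (q\<^sup>2) m = (\<Prod>j<n. 1 - q\<^sup>2 * (q\<^sup>2) ^ j)"
    using qpoch_inf_split[OF q2_lt, of "q\<^sup>2" n] by (simp add: qpoch_def m)
  thus ?thesis
    by (simp add: m rqfac_def power_mult power2_eq_square mult.assoc)
qed

text \<open>Read backwards, the factors are 1 + q^(-2j) and 1 + q^(-1-2j) for j < n. Clearing the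
  negative powers costs q^(4j+1) for each j, in total q^(2n^2 - n), so q^n remains.\<close>

lemma qpoch_weight:
  "qpoch (- (q powi (2 - 2 * int n))) (q\<^sup>2) (int n - 1) * qpoch (- (q powi (1 - 2 * int n))) (q\<^sup>2) (int n)
     * q powi (2 * (int n)\<^sup>2) = w n"
proof -
  have 1: "(\<Prod>j<n. 1 - - (q powi (b - 2 * int n)) * (q\<^sup>2) ^ j) = (\<Prod>j<n. 1 + q powi (b - 2 - 2 * int j))" for b
  proof -
    have "(\<Prod>j<n. 1 - - (q powi (b - 2 * int n)) * (q\<^sup>2) ^ j) = (\<Prod>j<n. 1 + q powi (b - 2 - 2 * int (n - Suc j)))"
    proof (rule prod.cong)
      fix j assume "j \<in> {..<n}"
      hence "b - 2 - 2 * int (n - Suc j) = b - 2 * int n + 2 * int j"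
        by (simp add: of_nat_diff)
      moreover have "(q\<^sup>2) ^ j = q powi (2 * int j)"
        by (simp add: q2_powi[symmetric])
      ultimately show "1 - - (q powi (b - 2 * int n)) * (q\<^sup>2) ^ j = 1 + q powi (b - 2 - 2 * int (n - Suc j))"
        by (simp only: mult_minus_left diff_minus_eq_add powi_mult)
    qed simp
    also have "\<dots> = (\<Prod>j<n. 1 + q powi (b - 2 - 2 * int j))"
      by (rule prod.nat_diff_reindex)
    finally show ?thesis .
  qed
  have split: "qpoch_inf (- (q powi (b - 2 * int n))) (q\<^sup>2) =
      (\<Prod>j<n. 1 + q powi (b - 2 - 2 * int j)) * qpoch_inf (- (q powi b)) (q\<^sup>2)" for b
  proof -
    have "q powi (b - 2 * int n) * (q\<^sup>2) powi int n = q powi b"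
      by (simp only: q2_powi powi_mult) simp
    thus ?thesis
      using qpoch_inf_split[OF q2_lt, of "- (q powi (b - 2 * int n))" n] unfolding 1
      by simp
  qed
  have nz: "qpoch_inf (- q) (q\<^sup>2) \<noteq> 0" "qpoch_inf (- q\<^sup>2) (q\<^sup>2) \<noteq> 0"
    using q_lt q2_lt by (simp_all add: qpoch_inf_nonzero_of_norm_less)
  \<comment> \<open>The index n - 1 leaves (-1; q^2)_inf in the denominator, where the other
    splitting has (-q^2; q^2)_inf. Their ratio 2 gives the division by 2, uniformly in n including n
    = 0.\<close>
  have "- (q powi (2 - 2 * int n)) * (q\<^sup>2) powi (int n - 1) = - 1"
    by (simp only: q2_powi mult_minus_left powi_mult) simp
  moreover have "qpoch_inf (- 1) (q\<^sup>2) = 2 * qpoch_inf (- q\<^sup>2) (q\<^sup>2)"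
    using qpoch_inf_split[OF q2_lt, of "- 1" 1] by simp
  ultimately have A: "qpoch (- (q powi (2 - 2 * int n))) (q\<^sup>2) (int n - 1) = (\<Prod>j<n. 1 + q powi (- 2 * int j)) / 2"
    unfolding qpoch_def split using nz by simp
  have "- (q powi (1 - 2 * int n)) * (q\<^sup>2) powi (int n) = - q"
    by (simp only: q2_powi mult_minus_left powi_mult) simp
  hence B: "qpoch (- (q powi (1 - 2 * int n))) (q\<^sup>2) (int n) = (\<Prod>j<n. 1 + q powi (- 1 - 2 * int j))"
    unfolding qpoch_def split using nz by simp
  have "(\<Prod>j<n. 1 + q powi (- 2 * int j)) * (\<Prod>j<n. 1 + q powi (- 1 - 2 * int j)) * q powi (2 * (int n)\<^sup>2)
      = 2 * v n * q ^ n"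
  proof (induction n)
    case (Suc n)
    have x: "q powi (2 * int n) = q ^ (2 * n)"
      by (metis of_nat_mult of_nat_numeral power_int_of_nat)
    have e: "2 * (int (Suc n))\<^sup>2 = 2 * (int n)\<^sup>2 + (2 * int n + (2 * int n + 1) + 1)"
      by (simp add: power2_eq_square algebra_simps)
    have f1: "(1 + q powi (- 2 * int n)) * q powi (2 * int n) = 1 + q ^ (2 * n)"
      unfolding x[symmetric] by (simp add: distrib_right powi_mult)
    have f2: "(1 + q powi (- 1 - 2 * int n)) * q powi (2 * int n + 1) = 1 + q ^ (2 * n + 1)"
      by (simp add: distrib_right powi_mult) (simp add: power_int_add q_nz x)
    have "(\<Prod>j<Suc n. 1 + q powi (- 2 * int j)) * (\<Prod>j<Suc n. 1 + q powi (- 1 - 2 * int j)) * q powi (2 * (int (Suc n))\<^sup>2)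
       = ((\<Prod>j<n. 1 + q powi (- 2 * int j)) * (\<Prod>j<n. 1 + q powi (- 1 - 2 * int j)) * q powi (2 * (int n)\<^sup>2))
         * ((1 + q powi (- 2 * int n)) * q powi (2 * int n)) * ((1 + q powi (- 1 - 2 * int n)) * q powi (2 * int n + 1)) * q"
      unfolding e powi_mult[symmetric] prod.lessThan_Suc by (simp only: power_int_1_right mult_ac)
    also have "\<dots> = 2 * v (Suc n) * q ^ Suc n"
      unfolding Suc.IH f1 f2 by (simp add: v_def)
    finally show ?case .
  qed (simp add: v_def)
  thus ?thesis unfolding A B w_def by simp
qed

text \<open>
  The factor \<open>edge i l (N l) (N (l + 1))\<close> carries the powers of \<open>q\<close> belonging to \<open>N\<^sub>l\<^sub>+\<^sub>1\<close>. Those of \<open>N\<^sub>1\<close> are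
  absorbed into \<open>w\<close>, where \<open>q\<close> to the power \<open>2 N\<^sub>1\<^sup>2\<close> cancels against the two shifted factorials in the numerator.
\<close>

definition edge :: "nat \<Rightarrow> nat \<Rightarrow> int \<Rightarrow> int \<Rightarrow> complex" where
  "edge i l a b = R (a - b) * q powi (2 * (b\<^sup>2 + (if i \<le> l then b else 0))) *
                  (if Suc l = i then 1 + q powi (2 * b) else 1)"

text \<open>Shifting indices by one takes N_1 out of the sums and brings in N_k = 0, which is
  neutral except for the factor 1 + q^0 when i = k > 1. For i = 1 no edge ends at N_i, hence the
  separate conditional.\<close>

lemma summand_eq:
  assumes "1 \<le> i" "i \<le> k" and N: "N \<in> pin k 1 (int n)"
  shows "summand k i q N = w n * (if i = 1 then 1 + q powi (2 * int n) else 1) *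
           (\<Prod>l\<in>{1..<k}. edge i l (N l) (N (Suc l)))"
proof -
  have N1: "N 1 = int n" and N0: "\<And>l. l < 1 \<or> k \<le> l \<Longrightarrow> N l = 0"
    and mono: "\<And>l. l \<in> {1..<k} \<Longrightarrow> 0 \<le> N (Suc l) \<and> N (Suc l) \<le> N l"
    using N by (auto simp: pin_def)
  have Rprod: "(\<Prod>j\<in>{1..<k - 1}. qpoch (q\<^sup>2) (q\<^sup>2) (N j - N (j + 1))) * qpoch (q\<^sup>2) (q\<^sup>2) (N (k - 1))
      = inverse (\<Prod>l\<in>{1..<k}. R (N l - N (Suc l)))"
  proof (cases "k = 1")
    case True
    thus ?thesis using N0[of 0] qpoch_q2[of 0] by simp
  next
    case False
    hence k: "1 \<le> k - 1" "Suc (k - 1) = k" using assms by auto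
    have "(\<Prod>l\<in>{1..<k}. R (N l - N (Suc l))) = (\<Prod>l\<in>{1..<k - 1}. R (N l - N (Suc l))) * R (N (k - 1))"
      using prod.atLeastLessThan_Suc[OF k(1), of "\<lambda>l. R (N l - N (Suc l))"] N0[of k] unfolding k(2) by simp
    moreover have "(\<Prod>j\<in>{1..<k - 1}. qpoch (q\<^sup>2) (q\<^sup>2) (N j - N (j + 1))) = (\<Prod>l\<in>{1..<k - 1}. inverse (R (N l - N (Suc l))))"
      using mono by (intro prod.cong) (auto intro!: qpoch_q2)
    moreover have "qpoch (q\<^sup>2) (q\<^sup>2) (N (k - 1)) = inverse (R (N (k - 1)))"
      using mono[of "k - 1"] k by (intro qpoch_q2) auto
    ultimately show ?thesis by (simp add: prod_inversef[symmetric] o_def)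
  qed
  have sq: "(\<Sum>j\<in>{1..<k}. (N j)\<^sup>2) = (int n)\<^sup>2 + (\<Sum>l\<in>{1..<k}. (N (Suc l))\<^sup>2)"
  proof -
    have "(\<Sum>j\<in>{1..<k}. (N j)\<^sup>2) = (\<Sum>j\<in>{1..<Suc k}. (N j)\<^sup>2)"
      using assms N0[of k] by (simp add: sum.atLeastLessThan_Suc)
    also have "\<dots> = (N 1)\<^sup>2 + (\<Sum>j\<in>{Suc 1..<Suc k}. (N j)\<^sup>2)"
      using assms by (intro sum.atLeast_Suc_lessThan) auto
    also have "(\<Sum>j\<in>{Suc 1..<Suc k}. (N j)\<^sup>2) = (\<Sum>l\<in>{1..<k}. (N (Suc l))\<^sup>2)"
      by (rule sum.shift_bounds_Suc_ivl)
    finally show ?thesis unfolding N1 .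
  qed
  have lin: "(\<Sum>j\<in>{i+1..<k}. N j) = (\<Sum>l\<in>{1..<k}. if i \<le> l then N (Suc l) else 0)"
  proof -
    have "(\<Sum>j\<in>{i+1..<k}. N j) = (\<Sum>j\<in>{Suc i..<Suc k}. N j)"
      using N0[of k] by (cases "Suc i \<le> k") (auto simp: sum.atLeastLessThan_Suc)
    also have "\<dots> = (\<Sum>l\<in>{i..<k}. N (Suc l))"
      by (rule sum.shift_bounds_Suc_ivl)
    also have "\<dots> = (\<Sum>l\<in>{1..<k}. if i \<le> l then N (Suc l) else 0)"
      using assms by (intro sum.mono_neutral_cong_left) auto
    finally show ?thesis .
  qed
  have fac: "1 + q powi (2 * N i) = (if i = 1 then 1 + q powi (2 * int n) else 1) *
      (\<Prod>l\<in>{1..<k}. if Suc l = i then 1 + q powi (2 * N (Suc l)) else 1)"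
  proof (cases "i = 1")
    case True
    hence "(\<Prod>l\<in>{1..<k}. if Suc l = i then 1 + q powi (2 * N (Suc l)) else 1) = 1"
      by (intro prod.neutral) auto
    thus ?thesis using True N1 by simp
  next
    case False
    have "(\<Prod>l\<in>{1..<k}. if Suc l = i then 1 + q powi (2 * N (Suc l)) else 1)
        = (\<Prod>l\<in>{1..<k}. if l = i - 1 then 1 + q powi (2 * N (Suc l)) else 1)"
      using assms by (intro prod.cong) auto
    also have "\<dots> = 1 + q powi (2 * N i)"
      using assms False by (subst prod.delta) auto
    finally show ?thesis using False by simp
  qed
  have pow: "q powi (2 * ((\<Sum>j\<in>{1..<k}. (N j)\<^sup>2) + (\<Sum>j\<in>{i+1..<k}. N j))) = q powi (2 * (int n)\<^sup>2) *
      (\<Prod>l\<in>{1..<k}. q powi (2 * ((N (Suc l))\<^sup>2 + (if i \<le> l then N (Suc l) else 0))))"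
  proof -
    have "2 * ((\<Sum>j\<in>{1..<k}. (N j)\<^sup>2) + (\<Sum>j\<in>{i+1..<k}. N j)) = 2 * (int n)\<^sup>2 +
        (\<Sum>l\<in>{1..<k}. 2 * ((N (Suc l))\<^sup>2 + (if i \<le> l then N (Suc l) else 0)))"
      unfolding sq lin sum_distrib_left[symmetric] sum.distrib by (simp add: distrib_left)
    thus ?thesis by (simp only: powi_mult[symmetric] powi_sum[OF finite_atLeastLessThan])
  qed
  have "summand k i q N = (qpoch (- (q powi (2 - 2 * int n))) (q\<^sup>2) (int n - 1) *
      qpoch (- (q powi (1 - 2 * int n))) (q\<^sup>2) (int n) * q powi (2 * (int n)\<^sup>2)) *
      (\<Prod>l\<in>{1..<k}. q powi (2 * ((N (Suc l))\<^sup>2 + (if i \<le> l then N (Suc l) else 0)))) *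
      ((if i = 1 then 1 + q powi (2 * int n) else 1) *
      (\<Prod>l\<in>{1..<k}. if Suc l = i then 1 + q powi (2 * N (Suc l)) else 1)) *
      (\<Prod>l\<in>{1..<k}. R (N l - N (Suc l)))"
    unfolding summand_def Rprod pow fac N1 by (simp add: divide_inverse mult_ac)
  also have "\<dots> = w n * (if i = 1 then 1 + q powi (2 * int n) else 1) *
           (\<Prod>l\<in>{1..<k}. edge i l (N l) (N (Suc l)))"
    unfolding qpoch_weight edge_def prod.distrib by (simp only: mult_ac)
  finally show ?thesis .
qed

lemma chain_sum_E:
  assumes "i \<le> j" "j \<le> k"
  shows "((\<lambda>s. c (k - j) s * E n s) has_sum chain_sum k (edge i) j n) UNIV"
  using assms(2,1)
proof (induction j arbitrary: n rule: inc_induct)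
  case base
  thus ?case using unit_bailey_pair by (simp add: chain_sum_self)
next
  case (step j)
  have "((\<lambda>s. c (k - Suc j) s * q powi (2 * (s\<^sup>2 + s)) * E n s) has_sum
      (\<Sum>r\<in>{0..n}. R (n - r) * q powi (2 * (r\<^sup>2 + r)) * chain_sum k (edge i) (Suc j) r)) UNIV"
    using step.IH step.prems by (intro bailey_step_E) auto
  moreover have "k - j = Suc (k - Suc j)" using step.hyps by simp
  moreover have "edge i j n r = R (n - r) * q powi (2 * (r\<^sup>2 + r))" for r
    using step.prems by (simp add: edge_def)
  ultimately show ?case
    using step.hyps by (simp only: c_Suc chain_sum_rec)
qed

definition d :: "nat \<Rightarrow> nat \<Rightarrow> nat \<Rightarrow> int \<Rightarrow> complex" where
  "d k i j s = (1 + q powi (2 * s)) * c (k - i) s * q powi (2 * int (i - j) * s\<^sup>2)"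

text \<open>\<open>chain_sum\<close> at level j weights only entries after j. At j = i the factor 1
  + p^(N_i) of the top entry must be supplied by hand; for j < i the edge into i carries it.\<close>

lemma chain_sum_D:
  assumes "i \<le> k" "j \<le> i"
  shows "((\<lambda>s. d k i j s * D n s) has_sum
    (if j = i then 1 + q powi (2 * n) else 1) * chain_sum k (edge i) j n) UNIV"
  using assms(2)
proof (induction j arbitrary: n rule: inc_induct)
  case base
  show ?case using bailey_E_imp_D[OF chain_sum_E[OF order_refl assms(1)]] by (simp add: d_def)
next
  case (step j)
  have "((\<lambda>s. d k i (Suc j) s * q powi (2 * s\<^sup>2) * D n s) has_sum
      (\<Sum>r\<in>{0..n}. R (n - r) * q powi (2 * r\<^sup>2) *
        ((if Suc j = i then 1 + q powi (2 * r) else 1) * chain_sum k (edge i) (Suc j) r))) UNIV"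
    by (intro bailey_step_D step.IH)
  moreover have "d k i (Suc j) s * q powi (2 * s\<^sup>2) = d k i j s" for s
  proof -
    have "2 * int (i - j) * s\<^sup>2 = 2 * int (i - Suc j) * s\<^sup>2 + 2 * s\<^sup>2"
      using step.hyps by (simp add: of_nat_diff algebra_simps)
    thus ?thesis by (simp only: d_def powi_mult[symmetric] mult_ac)
  qed
  moreover have "R (n - r) * q powi (2 * r\<^sup>2) *
      ((if Suc j = i then 1 + q powi (2 * r) else 1) * chain_sum k (edge i) (Suc j) r)
      = edge i j n r * chain_sum k (edge i) (Suc j) r" for r
    using step.hyps by (simp add: edge_def)
  ultimately show ?case
    using step.hyps assms(1) by (simp add: chain_sum_rec)
qed

text \<open>Up to sign \<open>d\<close> is a sum of two powers of q, with exponents \<open>A\<close>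
  and \<open>A + 2 * s\<close>. Both are nonnegative because s (s - 1) and s (s + 1) are, for
  integers s.\<close>

lemma norm_d_le: "norm (d k i j s) \<le> 2"
proof -
  define A where "A = s * (s - 1) + 2 * int (k - i) * (s\<^sup>2 + s) + 2 * int (i - j) * s\<^sup>2"
  have pos: "0 \<le> s * (s - 1)"
    by (cases "s \<le> 0") (auto intro: mult_nonpos_nonpos mult_nonneg_nonneg)
  have pos': "0 \<le> s * (s + 1)"
    by (cases "s < 0") (auto intro: mult_nonpos_nonpos mult_nonneg_nonneg)
  have sq: "s\<^sup>2 + s = s * (s + 1)" by (simp add: power2_eq_square algebra_simps)
  have rest: "0 \<le> 2 * int (k - i) * (s * (s + 1))"
    by (rule mult_nonneg_nonneg[OF _ pos']) simp
  have rest': "0 \<le> 2 * int (i - j) * s\<^sup>2"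
    by (rule mult_nonneg_nonneg) simp_all
  with rest have "0 \<le> A" unfolding A_def sq using pos by linarith
  moreover have "A + 2 * s = s * (s + 1) + 2 * int (k - i) * (s\<^sup>2 + s) + 2 * int (i - j) * s\<^sup>2"
    unfolding A_def by (simp only: algebra_simps)
  hence "0 \<le> A + 2 * s" unfolding sq using pos' rest rest' by linarith
  moreover have "d k i j s = (- 1) powi s * (q powi A + q powi (A + 2 * s))"
    unfolding d_def c_def A_def powi_mult[symmetric]
    by (simp only: distrib_left distrib_right mult_1 mult_1_right mult_ac)
  moreover have "norm ((- 1 :: complex) powi s) = 1"
    by (simp add: norm_power_int)
  ultimately show ?thesis
    using norm_powi_le_1[of A] norm_powi_le_1[of "A + 2 * s"] norm_triangle_ineq[of "q powi A" "q powi (A + 2 * s)"]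
    by (simp add: norm_mult)
qed

lemma norm_edge_le:
  assumes C: "\<And>n. norm (R n) \<le> C" "C \<ge> 1" and "0 \<le> b"
  shows "norm (edge i l a b) \<le> 2 * C"
proof -
  have "norm (edge i l a b) \<le> C * 1 * 2"
    unfolding edge_def norm_mult
  proof (intro mult_mono)
    show "norm (q powi (2 * (b\<^sup>2 + (if i \<le> l then b else 0)))) \<le> 1"
      using assms by (intro norm_powi_le_1) auto
    show "norm (if Suc l = i then 1 + q powi (2 * b) else 1) \<le> 2"
      using norm_triangle_ineq[of 1 "q powi (2 * b)"] norm_powi_le_1[of "2 * b"] assms by auto
  qed (use assms in auto)
  thus ?thesis by simp
qed

text \<open>The total exponent (2k-1) s^2 + 2 (k-i) s equals (2k-1) s (s - 1) + (4k-1-2i) s, which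
  dictates \<open>r\<close> and \<open>z\<close>; the triple product then has base r^2 =
  q^(4k-2).\<close>

lemma theta_sum:
  assumes "1 \<le> i" "i \<le> k"
  shows "((\<lambda>s. q powi s * c (k - i) s * q powi (2 * int (i - 1) * s\<^sup>2)) has_sum
    qpochs_inf [q ^ (2 * i - 1), q ^ (4 * k - 1 - 2 * i), q ^ (4 * k - 2)] (q ^ (4 * k - 2))) UNIV"
proof -
  define r where "r = q ^ (2 * k - 1)"
  define z where "z = q ^ (4 * k - 1 - 2 * i)"
  have "norm r < 1" using q_lt assms by (simp add: r_def norm_power power_less_one_iff)
  then interpret r: qbase r by unfold_locales (auto simp: r_def q_nz)
  have z: "z \<noteq> 0" by (simp add: z_def q_nz)
  have "2 * (2 * k - 1) = 4 * k - 2" by simp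
  hence r2: "r\<^sup>2 = q ^ (4 * k - 2)" unfolding r_def power_mult[symmetric] by (simp only: mult.commute)
  have "4 * k - 2 = (2 * i - 1) + (4 * k - 1 - 2 * i)" using assms by simp
  hence "r\<^sup>2 = q ^ (2 * i - 1) * z" unfolding r2 z_def by (simp only: power_add)
  hence r2z: "r\<^sup>2 / z = q ^ (2 * i - 1)" using z by simp
  have "(- z) powi s * r powi (s * (s - 1)) = q powi s * c (k - i) s * q powi (2 * int (i - 1) * s\<^sup>2)" for s
  proof -
    have 1: "z powi s = q powi (int (4 * k - 1 - 2 * i) * s)"
      unfolding z_def power_int_mult by (simp only: power_int_of_nat)
    have 2: "r powi (s * (s - 1)) = q powi (int (2 * k - 1) * (s * (s - 1)))"
      unfolding r_def power_int_mult by (simp only: power_int_of_nat)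
    have e: "int (4 * k - 1 - 2 * i) * s + int (2 * k - 1) * (s * (s - 1)) =
        s + (s * (s - 1) + 2 * int (k - i) * (s\<^sup>2 + s)) + 2 * int (i - 1) * s\<^sup>2"
      using assms by (simp add: of_nat_diff power2_eq_square algebra_simps)
    have "(- z) powi s = (- 1) powi s * z powi s"
      by (metis mult_minus1 power_int_mult_distrib)
    hence "(- z) powi s * r powi (s * (s - 1)) = (- 1) powi s * q powi (int (4 * k - 1 - 2 * i) * s + int (2 * k - 1) * (s * (s - 1)))"
      unfolding 1 2 powi_mult[symmetric] by (simp only: mult.assoc)
    also have "\<dots> = q powi s * c (k - i) s * q powi (2 * int (i - 1) * s\<^sup>2)"
      unfolding e powi_mult[symmetric] c_def by (simp only: mult_ac)
    finally show ?thesis .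
  qed
  thus ?thesis
    using r.jacobi_triple_product[OF z] unfolding r2z unfolding r2
    by (simp add: qpochs_inf_def z_def mult_ac)
qed

text \<open>One double series over n and s is summed in two ways: along s by the Bailey pair, along
  n by \<open>w_D_has_sum\<close>, whose denominator cancels the factor 1 + p^s of
  \<open>d\<close>.\<close>

lemma weighted_chain_sum:
  assumes "1 \<le> i" "i \<le> k"
  shows "((\<lambda>n. w n * ((if i = 1 then 1 + q powi (2 * int n) else 1) * chain_sum k (edge i) 1 (int n)))
    has_sum (qpoch_inf (- q) q / qpoch_inf q q *
     qpochs_inf [q ^ (2 * i - 1), q ^ (4 * k - 1 - 2 * i), q ^ (4 * k - 2)] (q ^ (4 * k - 2)))) UNIV"
proof -
  obtain C where C: "C \<ge> 1" "\<And>n. norm (R n) \<le> C" using R_bounded by blast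
  obtain W where W: "W > 0" "\<And>n. norm (w n) \<le> W * norm q ^ n" using w_bounded by blast
  define f where "f = (\<lambda>(n, s). w n * (d k i 1 s * D (int n) s))"
  \<comment> \<open>The kernel restricts s to 2n + 1 values; there \<open>d\<close> contributes at
    most 2 and each \<open>R\<close> at most \<open>C\<close>.\<close>
  define g where "g = (\<lambda>(n, s). if s \<in> {- int n..int n} then W * norm q ^ n * (2 * (C * C)) else 0)"
  have "g summable_on UNIV \<times> UNIV"
  proof (rule summable_on_SigmaI)
    show "((\<lambda>s. g (n, s)) has_sum real (2 * n + 1) * (W * norm q ^ n * (2 * (C * C)))) UNIV" for n
    proof (rule has_sum_finite_neutralI[of "{- int n..int n}"])
      have "(\<Sum>s\<in>{- int n..int n}. g (n, s)) = (\<Sum>s\<in>{- int n..int n}. W * norm q ^ n * (2 * (C * C)))"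
        by (intro sum.cong) (auto simp: g_def)
      also have "\<dots> = real (nat (2 * int n + 1)) * (W * norm q ^ n * (2 * (C * C)))" by simp
      also have "nat (2 * int n + 1) = 2 * n + 1" by simp
      finally show "real (2 * n + 1) * (W * norm q ^ n * (2 * (C * C))) = (\<Sum>s\<in>{- int n..int n}. g (n, s))" ..
    qed (auto simp: g_def)
    have "(\<lambda>n. 4 * (C * C) * W * (real (Suc n) ^ 1 * norm q ^ n)) summable_on UNIV"
      using q_lt q_nz C(1) W(1)
      by (intro summable_nonneg_imp_summable_on summable_mult summable_poly_geometric) auto
    thus "(\<lambda>n. real (2 * n + 1) * (W * norm q ^ n * (2 * (C * C)))) summable_on UNIV"
    proof (rule summable_on_comparison_test)
      fix n
      have "real (2 * n + 1) * (W * norm q ^ n * (2 * (C * C))) \<le> (2 * real (Suc n)) * (W * norm q ^ n * (2 * (C * C)))"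
        using C(1) W(1) by (intro mult_right_mono) auto
      thus "real (2 * n + 1) * (W * norm q ^ n * (2 * (C * C))) \<le> 4 * (C * C) * W * (real (Suc n) ^ 1 * norm q ^ n)"
        by (simp only: power_one_right) (simp add: algebra_simps)
      show "0 \<le> real (2 * n + 1) * (W * norm q ^ n * (2 * (C * C)))" using C(1) W(1) by auto
    qed
    show "0 \<le> g (n, s)" for n s using C(1) W(1) by (auto simp: g_def)
  qed
  moreover have "norm (f x) \<le> g x" for x
  proof (cases x)
    case (Pair n s)
    show ?thesis
    proof (cases "s \<in> {- int n..int n}")
      case True
      have "norm (w n * (d k i 1 s * D (int n) s)) \<le> W * norm q ^ n * (2 * (C * C))"
        unfolding norm_mult D_def using C W norm_d_le by (intro mult_mono) auto
      thus ?thesis using True by (simp add: f_def g_def Pair)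
    next
      case False
      hence "D (int n) s = 0" by (intro D_eq_0) auto
      thus ?thesis using False by (auto simp: f_def g_def Pair)
    qed
  qed
  ultimately have "f summable_on UNIV \<times> UNIV"
    by (rule summable_on_dominated)
  then obtain T where T: "(f has_sum T) (UNIV \<times> UNIV)" by (auto simp: summable_on_def)
  have rows: "((\<lambda>n. w n * ((if i = 1 then 1 + q powi (2 * int n) else 1) * chain_sum k (edge i) 1 (int n))) has_sum T) UNIV"
  proof (rule has_sum_Sigma'[OF T])
    fix n
    have "((\<lambda>s. d k i 1 s * D (int n) s) has_sum
        ((if 1 = i then 1 + q powi (2 * int n) else 1) * chain_sum k (edge i) 1 (int n))) UNIV"
      using assms by (intro chain_sum_D) auto
    from has_sum_cmult_right[OF this, of "w n"]
    show "((\<lambda>s. f (n, s)) has_sum w n * ((if i = 1 then 1 + q powi (2 * int n) else 1) * chain_sum k (edge i) 1 (int n))) UNIV"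
      by (simp only: f_def prod.case eq_commute[of 1 i])
  qed
  have "((\<lambda>s. qpoch_inf (- q) q / qpoch_inf q q * (q powi s * c (k - i) s * q powi (2 * int (i - 1) * s\<^sup>2))) has_sum T) UNIV"
  proof (rule has_sum_Sigma'[OF T[unfolded has_sum_swap[of f]]])
    fix s
    have "((\<lambda>n. d k i 1 s * (w n * D (int n) s)) has_sum
      d k i 1 s * (qpoch_inf (- q) q / qpoch_inf q q * q powi s / (1 + q powi (2 * s)))) UNIV"
      by (intro has_sum_cmult_right w_D_has_sum)
    also have "d k i 1 s * (qpoch_inf (- q) q / qpoch_inf q q * q powi s / (1 + q powi (2 * s)))
      = qpoch_inf (- q) q / qpoch_inf q q * (q powi s * c (k - i) s * q powi (2 * int (i - 1) * s\<^sup>2))"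
      using one_plus_powi_nonzero[of s] by (simp add: d_def)
    finally show "((\<lambda>n. case (s, n) of (x, y) \<Rightarrow> f (y, x)) has_sum
      qpoch_inf (- q) q / qpoch_inf q q * (q powi s * c (k - i) s * q powi (2 * int (i - 1) * s\<^sup>2))) UNIV"
      by (simp add: f_def mult_ac)
  qed
  moreover have "((\<lambda>s. qpoch_inf (- q) q / qpoch_inf q q * (q powi s * c (k - i) s * q powi (2 * int (i - 1) * s\<^sup>2))) has_sum
    qpoch_inf (- q) q / qpoch_inf q q *
     qpochs_inf [q ^ (2 * i - 1), q ^ (4 * k - 1 - 2 * i), q ^ (4 * k - 2)] (q ^ (4 * k - 2))) UNIV"
    by (intro has_sum_cmult_right theta_sum assms)
  ultimately have "T = qpoch_inf (- q) q / qpoch_inf q q *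
     qpochs_inf [q ^ (2 * i - 1), q ^ (4 * k - 1 - 2 * i), q ^ (4 * k - 2)] (q ^ (4 * k - 2))"
    by (rule has_sum_unique)
  thus ?thesis using rows by simp
qed

text \<open>Convergence of the sum of the fibre totals does not give unordered summability of the
  terms. Putting norms into \<open>chain_sum\<close> does, with a majorant of order (n + 1)^(k-1)
  |q|^n.\<close>

lemma summand_summable:
  assumes "1 \<le> i" "i \<le> k"
  shows "(\<lambda>x. summand k i q (snd x)) summable_on (SIGMA n:UNIV. pin k 1 (int n))"
proof -
  obtain C where C: "C \<ge> 1" "\<And>n. norm (R n) \<le> C" using R_bounded by blast
  obtain W where W: "W > 0" "\<And>n. norm (w n) \<le> W * norm q ^ n" using w_bounded by blast
  define \<phi> where "\<phi> = (\<lambda>l a b. norm (edge i l a b))"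
  define g where "g = (\<lambda>(n, N). W * norm q ^ n * 2 * (\<Prod>l\<in>{1..<k}. \<phi> l (N l) (N (Suc l))))"
  have chain: "0 \<le> chain_sum k \<phi> 1 (int n) \<and> chain_sum k \<phi> 1 (int n) \<le> (2 * C * (real_of_int (int n) + 1)) ^ (k - 1)" for n
    using assms C(1) norm_edge_le[OF C(2) C(1)] by (intro chain_sum_le) (auto simp: \<phi>_def)
  have "g summable_on (SIGMA n:UNIV. pin k 1 (int n))"
  proof (rule summable_on_SigmaI)
    show "((\<lambda>N. g (n, N)) has_sum W * norm q ^ n * 2 * chain_sum k \<phi> 1 (int n)) (pin k 1 (int n))" for n
      using assms by (intro has_sum_finiteI finite_pin) (auto simp: g_def chain_sum_def sum_distrib_left)
    have "(\<lambda>n. W * 2 * (2 * C) ^ (k - 1) * (real (Suc n) ^ (k - 1) * norm q ^ n)) summable_on UNIV"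
      using q_lt q_nz C(1) W(1)
      by (intro summable_nonneg_imp_summable_on summable_mult summable_poly_geometric) auto
    thus "(\<lambda>n. W * norm q ^ n * 2 * chain_sum k \<phi> 1 (int n)) summable_on UNIV"
    proof (rule summable_on_comparison_test)
      fix n
      have "W * norm q ^ n * 2 * chain_sum k \<phi> 1 (int n) \<le> W * norm q ^ n * 2 * (2 * C * (real_of_int (int n) + 1)) ^ (k - 1)"
        using chain[of n] W(1) by (intro mult_left_mono) auto
      also have "real_of_int (int n) + 1 = real (Suc n)" by simp
      also have "W * norm q ^ n * 2 * (2 * C * real (Suc n)) ^ (k - 1) = W * 2 * (2 * C) ^ (k - 1) * (real (Suc n) ^ (k - 1) * norm q ^ n)"
        by (simp only: power_mult_distrib mult_ac)
      finally show "W * norm q ^ n * 2 * chain_sum k \<phi> 1 (int n) \<le> W * 2 * (2 * C) ^ (k - 1) * (real (Suc n) ^ (k - 1) * norm q ^ n)" .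
      show "0 \<le> W * norm q ^ n * 2 * chain_sum k \<phi> 1 (int n)"
        using chain[of n] W(1) by auto
    qed
    show "0 \<le> g (n, N)" for n N
      using W(1) by (auto simp: g_def \<phi>_def intro!: mult_nonneg_nonneg prod_nonneg)
  qed
  moreover have "norm (summand k i q (snd x)) \<le> g x" if x_mem: "x \<in> (SIGMA n:UNIV. pin k 1 (int n))" for x
  proof -
    obtain n N where x: "x = (n, N)" and N: "N \<in> pin k 1 (int n)" using x_mem by auto
    have "norm (if i = 1 then 1 + q powi (2 * int n) else 1) \<le> 2"
      using norm_triangle_ineq[of 1 "q powi (2 * int n)"] norm_powi_le_1[of "2 * int n"] by auto
    hence "norm (summand k i q N) \<le> W * norm q ^ n * 2 * norm (\<Prod>l\<in>{1..<k}. edge i l (N l) (N (Suc l)))"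
      unfolding summand_eq[OF assms N] norm_mult using W
      by (intro mult_mono) auto
    thus ?thesis by (simp add: x g_def \<phi>_def prod_norm)
  qed
  ultimately show ?thesis by (rule summable_on_dominated)
qed

lemma summand_has_sum:
  assumes "1 \<le> i" "i \<le> k"
  shows "(summand k i q has_sum (qpoch_inf (- q) q / qpoch_inf q q *
     qpochs_inf [q ^ (2 * i - 1), q ^ (4 * k - 1 - 2 * i), q ^ (4 * k - 2)] (q ^ (4 * k - 2)))) (tuples k)"
proof -
  have "((\<lambda>x. summand k i q (snd x)) has_sum (qpoch_inf (- q) q / qpoch_inf q q *
     qpochs_inf [q ^ (2 * i - 1), q ^ (4 * k - 1 - 2 * i), q ^ (4 * k - 2)] (q ^ (4 * k - 2))))
     (SIGMA n:UNIV. pin k 1 (int n))"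
  proof (rule has_sum_SigmaI[OF _ weighted_chain_sum[OF assms] summand_summable[OF assms]])
    fix n
    have "(\<Sum>N\<in>pin k 1 (int n). summand k i q N) =
        w n * ((if i = 1 then 1 + q powi (2 * int n) else 1) * chain_sum k (edge i) 1 (int n))"
      unfolding chain_sum_def sum_distrib_left
      by (intro sum.cong refl) (simp only: summand_eq[OF assms] mult.assoc)
    thus "((\<lambda>N. summand k i q (snd (n, N))) has_sum
        w n * ((if i = 1 then 1 + q powi (2 * int n) else 1) * chain_sum k (edge i) 1 (int n))) (pin k 1 (int n))"
      using assms by (intro has_sum_finiteI finite_pin) auto
  qed
  thus ?thesis
    using has_sum_reindex_bij_betw[OF bij_betw_pin_tuples, of k "summand k i q"] assms by simp
qed

end

theorem theorem1p8:
  fixes k i :: nat and q :: complex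
  assumes "1 \<le> i" and "i \<le> k"
    and "q \<noteq> 0" and "norm q < 1"
  shows "(summand k i q has_sum
           (qpoch_inf (- q) q *
            qpochs_inf [q ^ (2 * i - 1), q ^ (4 * k - 1 - 2 * i), q ^ (4 * k - 2)] (q ^ (4 * k - 2)) /
            qpoch_inf q q))
         (tuples k)"
proof -
  interpret qbase q using assms by unfold_locales
  show ?thesis using summand_has_sum[OF assms(1,2)] by simp
qed

end
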